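(* Let $\varphi(s)=c_0s+c_1+\sum_{n=2}^N c_n n^{-s}$ be a member of the Gordon--Hedenmalm class $\mathcal G$ with characteristic $c_0\geq 1$. Then the composition operator $\mathcal C_\varphi$ is compact on $\mathcal H^2$ if and only if $\varphi$ has restricted range.
   Context: For $\theta\in\mathbb R$, $\mathbb C_\theta=\{s\in\mathbb C: \mathrm{Re}\,s>\theta\}$. $\mathcal H^2$ is the Hilbert space of Dirichlet series $f(s)=\sum_{n\ge1}a_nn^{-s}$ with norm $\|f\|_{\mathcal H^2}^2=\sum_{n\ge1}|a_n|^2<\infty$; its elements are analytic in $\mathbb C_{1/2}$. The Gordon--Hedenmalm class $\mathcal G$ is the set of functions $\varphi:\mathbb C_{1/2}\to\mathbb C_{1/2}$ of the form $\varphi(s)=c_0s+\varphi_0(s)$ with $\varphi_0(s)=\sum_{n\ge1}c_nn^{-s}$, where $c_0$ is a non-negative integer (the characteristic of $\varphi$), the Dirichlet series $\varphi_0$ converges uniformly in $\mathbb C_\varepsilon$ for every $\varepsilon>0$, and: (a) if $c_0=0$ then $\varphi_0(\mathbb C_0)\subset\mathbb C_{1/2}$; (b) if $c_0\ge1$ then either $\varphi_0\equiv0$ or $\varphi_0(\mathbb C_0)\subset\mathbb C_0$. For $\varphi\in\mathcal G$, the operator $\mathcal C_\varphi f=f\circ\varphi$ is well defined and bounded on $\mathcal H^2$. A Dirichlet polynomial symbol $\varphi\in\mathcal G$ has unrestricted range if $\inf_{s\in\mathbb C_0}\mathrm{Re}\,\varphi(s)$ equals $1/2$ when $c_0=0$,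 respectively $0$ when $c_0\ge1$; otherwise it has restricted range, i.e. $\varphi(\mathbb C_0)$ is contained in a strictly smaller half-plane. *)

theory Defs
  imports "HOL-Analysis.Analysis"
begin

definition right_halfplane :: "real \<Rightarrow> complex set" where
  "right_halfplane \<theta> = {s. \<theta> < Re s}"

text \<open>The summation starts at 0 only formally: \<open>0 powr z = 0\<close>, so the coefficient \<open>a 0\<close> plays no role.\<close>

definition dirichlet_series :: "(nat \<Rightarrow> complex) \<Rightarrow> complex \<Rightarrow> complex" where
  "dirichlet_series a s = (\<Sum>n. a n * of_nat n powr (- s))"

subsection \<open>The Hardy space of Dirichlet series\<close>

text \<open>The dummy coefficient at index 0 is normalised to 0, so that coefficients are unique.\<close>

definition square_summable :: "(nat \<Rightarrow> complex) set" where
  "square_summable = {a. a 0 = 0 \<and> summable (\<lambda>n. (cmod (a n))\<^sup>2)}"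

text \<open>Elements of the space are functions on the half-plane \<open>Re s > 1/2\<close>. As HOL functions are
  total, they are represented by their extensions by 0, so that equality of elements is equality
  of HOL functions.\<close>

definition h2_fun :: "(nat \<Rightarrow> complex) \<Rightarrow> complex \<Rightarrow> complex" where
  "h2_fun a = (\<lambda>s. if s \<in> right_halfplane (1/2) then dirichlet_series a s else 0)"

definition H2 :: "(complex \<Rightarrow> complex) set" where
  "H2 = h2_fun ` square_summable"

text \<open>The map \<open>h2_fun\<close> is injective on \<open>square_summable\<close>, see \<open>inj_on_h2_fun\<close> below.\<close>

definition h2_coeff :: "(complex \<Rightarrow> complex) \<Rightarrow> nat \<Rightarrow> complex" where
  "h2_coeff f = the_inv_into square_summable h2_fun f"

text \<open>The value 0 outside \<open>H2\<close> is needed because the locale \<open>Metric_space\<close> demands nonnegativity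
  and symmetry of the distance function on the whole type.\<close>

definition h2_norm :: "(complex \<Rightarrow> complex) \<Rightarrow> real" where
  "h2_norm f = (if f \<in> H2 then sqrt (\<Sum>n. (cmod (h2_coeff f n))\<^sup>2) else 0)"

definition h2_dist :: "(complex \<Rightarrow> complex) \<Rightarrow> (complex \<Rightarrow> complex) \<Rightarrow> real" where
  "h2_dist f g = h2_norm (\<lambda>s. f s - g s)"

lemma dirichlet_series_summable:
  assumes "a \<in> square_summable" "s \<in> right_halfplane (1/2)"
  shows "summable (\<lambda>n. a n * of_nat n powr (- s))"
proof (rule summable_comparison_test')
  have 1: "summable (\<lambda>n. (cmod (a n))\<^sup>2)"
    using assms(1) by (simp add: square_summable_def)
  have "summable (\<lambda>n. real n powr (- 2 * Re s))"
    using assms(2) by (subst summable_real_powr_iff) (simp add: right_halfplane_def)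
  from summable_add[OF 1 this]
  show "summable (\<lambda>n. (cmod (a n))\<^sup>2 + real n powr (- 2 * Re s))" .
  fix n :: nat
  assume n: "n \<ge> 1"
  have c: "cmod (of_nat n powr (- s)) = real n powr (- Re s)"
    using n by (subst norm_powr_real_powr) auto
  have sq: "real n powr (- 2 * Re s) = (real n powr (- Re s))\<^sup>2"
    using n by (simp add: power2_eq_square flip: powr_add)
  have "2 * (cmod (a n) * real n powr (- Re s)) \<le> (cmod (a n))\<^sup>2 + (real n powr (- Re s))\<^sup>2"
    using sum_squares_bound[of "cmod (a n)" "real n powr (- Re s)"] by simp
  moreover have "0 \<le> cmod (a n) * real n powr (- Re s)" by simp
  ultimately show "cmod (a n * of_nat n powr (- s)) \<le> (cmod (a n))\<^sup>2 + real n powr (- 2 * Re s)"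
    unfolding norm_mult c sq by linarith
qed

lemma square_summable_bounds:
  assumes "a \<in> square_summable" "b \<in> square_summable"
  shows square_summable_diff: "(\<lambda>n. a n - b n) \<in> square_summable"
    and l2_triangle: "sqrt (\<Sum>n. (cmod (a n - b n))\<^sup>2)
           \<le> sqrt (\<Sum>n. (cmod (a n))\<^sup>2) + sqrt (\<Sum>n. (cmod (b n))\<^sup>2)"
proof -
  have sa: "summable (\<lambda>n. (cmod (a n))\<^sup>2)" and sb: "summable (\<lambda>n. (cmod (b n))\<^sup>2)"
    using assms by (auto simp: square_summable_def)
  define K where "K = sqrt (\<Sum>n. (cmod (a n))\<^sup>2) + sqrt (\<Sum>n. (cmod (b n))\<^sup>2)"
  have K0: "K \<ge> 0" by (simp add: K_def suminf_nonneg sa sb)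
  have fin: "(\<Sum>n<N. (cmod (a n - b n))\<^sup>2) \<le> K\<^sup>2" for N
  proof -
    have "sqrt (\<Sum>n<N. (cmod (a n - b n))\<^sup>2) = L2_set (\<lambda>n. cmod (a n - b n)) {..<N}"
      by (simp add: L2_set_def)
    also have "\<dots> \<le> L2_set (\<lambda>n. cmod (a n) + cmod (b n)) {..<N}"
      by (rule L2_set_mono) (auto intro: norm_triangle_ineq4)
    also have "\<dots> \<le> L2_set (\<lambda>n. cmod (a n)) {..<N} + L2_set (\<lambda>n. cmod (b n)) {..<N}"
      by (rule L2_set_triangle_ineq)
    also have "\<dots> \<le> K"
      unfolding L2_set_def K_def
      by (intro add_mono real_sqrt_le_mono sum_le_suminf sa sb) auto
    finally have "sqrt (\<Sum>n<N. (cmod (a n - b n))\<^sup>2) \<le> K" .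
    then show ?thesis
      using K0 real_le_lsqrt sqrt_le_D by blast
  qed
  have sd: "summable (\<lambda>n. (cmod (a n - b n))\<^sup>2)"
    by (rule summableI_nonneg_bounded[OF _ fin]) auto
  then show "(\<lambda>n. a n - b n) \<in> square_summable"
    using assms by (auto simp: square_summable_def)
  have "(\<Sum>n. (cmod (a n - b n))\<^sup>2) \<le> K\<^sup>2"
    by (rule suminf_le_const[OF sd fin])
  then show "sqrt (\<Sum>n. (cmod (a n - b n))\<^sup>2) \<le> sqrt (\<Sum>n. (cmod (a n))\<^sup>2) + sqrt (\<Sum>n. (cmod (b n))\<^sup>2)"
    using K0 unfolding K_def[symmetric] by (simp add: real_le_lsqrt)
qed

lemma h2_fun_diff:
  assumes "a \<in> square_summable" "b \<in> square_summable"
  shows "h2_fun (\<lambda>n. a n - b n) = (\<lambda>s. h2_fun a s - h2_fun b s)"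
proof
  fix s
  show "h2_fun (\<lambda>n. a n - b n) s = h2_fun a s - h2_fun b s"
  proof (cases "s \<in> right_halfplane (1/2)")
    case True
    from suminf_diff[OF dirichlet_series_summable[OF assms(1) True]
        dirichlet_series_summable[OF assms(2) True]]
    show ?thesis using True by (simp add: h2_fun_def dirichlet_series_def left_diff_distrib)
  qed (simp add: h2_fun_def)
qed

lemma dirichlet_series_coeff_zero:
  assumes d: "d \<in> square_summable"
    and zero: "\<And>s. s \<in> right_halfplane (1/2) \<Longrightarrow> dirichlet_series d s = 0"
  shows "d n = 0"
proof (induction n rule: less_induct)
  case (less k)
  show ?case
  proof (cases "k = 0")
    case True
    then show ?thesis using d by (simp add: square_summable_def)
  next
    case False
    then have k: "k \<ge> 1" by simp
    have "summable (\<lambda>n. (cmod (d n))\<^sup>2)"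
      using d by (simp add: square_summable_def)
    then have "(\<lambda>n. (cmod (d n))\<^sup>2) \<longlonglongrightarrow> 0" by (rule summable_LIMSEQ_zero)
    then have "Bseq (\<lambda>n. (cmod (d n))\<^sup>2)" by (metis convergentI convergent_imp_Bseq)
    then obtain C where "\<And>n. norm ((cmod (d n))\<^sup>2) \<le> C" by (auto simp: Bseq_def)
    then have M: "cmod (d n) \<le> sqrt C" for n
      by (simp add: real_le_rsqrt)
    define q where "q = real k / real (Suc k)"
    have q: "0 \<le> q" "q < 1" by (auto simp: q_def)
    define g where "g = (\<lambda>n. sqrt C * real k ^ 2 * (1 / real n ^ 2))"
    have sg: "summable g"
      unfolding g_def using inverse_power_summable[of 2, where ?'a = real]
      by (intro summable_mult) (simp add: field_simps)
    have C0: "sqrt C \<ge> 0" using M[of 0] by (meson norm_ge_zero order_trans)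
    have g0: "g n \<ge> 0" for n
      unfolding g_def by (intro mult_nonneg_nonneg C0) auto
    have key: "cmod (d k) \<le> suminf g * q ^ m" for m :: nat
    proof -
      define s where "s = (of_nat (m + 2) :: complex)"
      have s: "s \<in> right_halfplane (1/2)" by (simp add: s_def right_halfplane_def)
      have pw: "of_nat n powr (- s) = 1 / of_nat n ^ (m + 2)" if "n \<ge> 1" for n :: nat
        using that powr_nat'[of "of_nat n :: complex" "m + 2"] unfolding s_def
        by (subst powr_minus) (simp add: field_simps del: of_nat_add power_Suc)
      define t where "t = (\<lambda>n. d n * of_nat n powr (- s))"
      have st: "summable t" unfolding t_def by (rule dirichlet_series_summable[OF d s])
      have lowz: "t n = 0" if "n < k" for n using less.IH[OF that] by (simp add: t_def)
      have "0 = suminf t" using zero[OF s] by (simp add: dirichlet_series_def t_def)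
      also have "\<dots> = (\<Sum>n. t (n + Suc k)) + (\<Sum>n<Suc k. t n)"
        by (rule suminf_split_initial_segment[OF st])
      also have "(\<Sum>n<Suc k. t n) = t k" using lowz by simp
      finally have tk: "t k = - (\<Sum>n. t (n + Suc k))" by (simp add: add_eq_0_iff)
      have bd: "norm (t (n + Suc k)) \<le> g (n + Suc k) * q ^ m / real k ^ (m + 2)" for n
      proof -
        define j where "j = n + Suc k"
        have j: "j \<ge> Suc k" by (simp add: j_def)
        have "norm (t j) = cmod (d j) * (1 / real j ^ (m + 2))"
          using j by (simp add: t_def pw norm_mult norm_divide norm_power)
        also have "\<dots> \<le> sqrt C * (1 / real j ^ (m + 2))"
          by (intro mult_right_mono M) auto
        also have "\<dots> = sqrt C * (1 / real j ^ 2) * (1 / real j) ^ m"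
          by (simp add: power_add power_divide power2_eq_square)
        also have "\<dots> \<le> sqrt C * (1 / real j ^ 2) * (1 / real (Suc k)) ^ m"
          using j C0 by (intro mult_left_mono power_mono) (auto simp: field_simps)
        also have "\<dots> = g j * q ^ m / real k ^ (m + 2)"
          using k by (simp add: g_def q_def power_add power_divide power2_eq_square field_simps)
        finally show ?thesis by (simp add: j_def)
      qed
      have sh: "summable (\<lambda>n. g (n + Suc k) * q ^ m / real k ^ (m + 2))"
        using sg by (intro summable_divide summable_mult2) (simp only: summable_iff_shift)
      have "norm (t k) \<le> (\<Sum>n. norm (t (n + Suc k)))"
        unfolding tk norm_minus_cancel
        by (intro summable_norm summable_comparison_test'[OF sh]) (use bd in auto)
      also have "\<dots> \<le> (\<Sum>n. g (n + Suc k) * q ^ m / real k ^ (m + 2))"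
        by (intro suminf_le bd sh summable_comparison_test'[OF sh]) (use bd in auto)
      also have "\<dots> = (\<Sum>n. g (n + Suc k)) * q ^ m / real k ^ (m + 2)"
      proof -
        have sgk: "summable (\<lambda>n. g (n + Suc k))" using sg by (simp only: summable_iff_shift)
        show ?thesis
          by (simp only: suminf_divide[OF summable_mult2[OF sgk]] suminf_mult2[OF sgk])
      qed
      also have "\<dots> \<le> suminf g * q ^ m / real k ^ (m + 2)"
      proof -
        have "suminf g = (\<Sum>n. g (n + Suc k)) + (\<Sum>n<Suc k. g n)"
          by (rule suminf_split_initial_segment[OF sg])
        then have "(\<Sum>n. g (n + Suc k)) \<le> suminf g"
          using sum_nonneg[of "{..<Suc k}" g, OF g0] by linarith
        then show ?thesis using q by (intro divide_right_mono mult_right_mono) auto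
      qed
      finally have "norm (t k) * real k ^ (m + 2) \<le> suminf g * q ^ m"
        using k by (simp add: field_simps)
      moreover have "norm (t k) * real k ^ (m + 2) = cmod (d k)"
        using k by (simp add: t_def pw norm_mult norm_divide norm_power)
      ultimately show ?thesis by simp
    qed
    have "(\<lambda>m. suminf g * q ^ m) \<longlonglongrightarrow> suminf g * 0"
      using q by (intro tendsto_mult tendsto_const LIMSEQ_realpow_zero) auto
    then have "cmod (d k) \<le> suminf g * 0"
      by (rule LIMSEQ_le_const) (use key in auto)
    then show ?thesis by simp
  qed
qed

lemma inj_on_h2_fun: "inj_on h2_fun square_summable"
proof (rule inj_onI)
  fix a b
  assume ab: "a \<in> square_summable" "b \<in> square_summable" "h2_fun a = h2_fun b"
  have "dirichlet_series (\<lambda>n. a n - b n) s = 0" if "s \<in> right_halfplane (1/2)" for s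
    using fun_cong[OF h2_fun_diff[OF ab(1,2)], of s] fun_cong[OF ab(3), of s] that
    by (simp add: h2_fun_def)
  from dirichlet_series_coeff_zero[OF square_summable_diff[OF ab(1,2)] this]
  show "a = b" by (auto simp: fun_eq_iff)
qed

lemma h2_norm_h2_fun:
  "a \<in> square_summable \<Longrightarrow> h2_norm (h2_fun a) = sqrt (\<Sum>n. (cmod (a n))\<^sup>2)"
  by (simp add: h2_norm_def H2_def h2_coeff_def the_inv_into_f_f[OF inj_on_h2_fun])

lemma h2_dist_h2_fun:
  assumes "a \<in> square_summable" "b \<in> square_summable"
  shows "h2_dist (h2_fun a) (h2_fun b) = sqrt (\<Sum>n. (cmod (a n - b n))\<^sup>2)"
  using h2_norm_h2_fun[OF square_summable_diff[OF assms]] h2_fun_diff[OF assms]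
  by (simp add: h2_dist_def)

lemma h2_norm_nonneg: "0 \<le> h2_norm f"
proof (cases "f \<in> H2")
  case True
  then obtain a where "a \<in> square_summable" "f = h2_fun a" by (auto simp: H2_def)
  then show ?thesis by (simp add: h2_norm_h2_fun) (simp add: suminf_nonneg square_summable_def)
qed (simp add: h2_norm_def)

lemma zero_square_summable: "(\<lambda>n. 0) \<in> square_summable"
  by (simp add: square_summable_def)

lemma h2_fun_zero: "h2_fun (\<lambda>n. 0) = (\<lambda>s. 0)"
  by (auto simp: h2_fun_def dirichlet_series_def)

lemma h2_uminus:
  assumes "f \<in> H2"
  shows "(\<lambda>s. - f s) \<in> H2" "h2_norm (\<lambda>s. - f s) = h2_norm f"
proof -
  obtain a where a: "a \<in> square_summable" "f = h2_fun a" using assms by (auto simp: H2_def)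
  have "(\<lambda>n. 0 - a n) \<in> square_summable" "h2_fun (\<lambda>n. 0 - a n) = (\<lambda>s. - f s)"
    using square_summable_diff[OF zero_square_summable a(1)]
      h2_fun_diff[OF zero_square_summable a(1)] by (auto simp: a h2_fun_zero)
  then show "(\<lambda>s. - f s) \<in> H2" "h2_norm (\<lambda>s. - f s) = h2_norm f"
    using h2_norm_h2_fun[of "\<lambda>n. 0 - a n"] h2_norm_h2_fun[OF a(1)] a
    by (auto simp: H2_def intro: image_eqI[of _ _ "\<lambda>n. - a n"])
qed

global_interpretation h2: Metric_space H2 h2_dist
proof
  fix f g
  show "0 \<le> h2_dist f g" by (simp add: h2_dist_def h2_norm_nonneg)
  show "h2_dist f g = h2_dist g f"
  proof (cases "(\<lambda>s. f s - g s) \<in> H2")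
    case True
    from h2_uminus(2)[OF this] show ?thesis by (simp add: h2_dist_def)
  next
    case False
    then have "(\<lambda>s. g s - f s) \<notin> H2"
      using h2_uminus(1)[of "\<lambda>s. g s - f s"] by auto
    with False show ?thesis by (simp add: h2_dist_def h2_norm_def)
  qed
next
  fix f g assume "f \<in> H2" "g \<in> H2"
  then obtain a b where ab: "a \<in> square_summable" "f = h2_fun a" "b \<in> square_summable" "g = h2_fun b"
    by (auto simp: H2_def)
  have s: "summable (\<lambda>n. (cmod (a n - b n))\<^sup>2)"
    using square_summable_diff[OF ab(1,3)] by (simp add: square_summable_def)
  have "h2_dist f g = 0 \<longleftrightarrow> (\<Sum>n. (cmod (a n - b n))\<^sup>2) = 0"
    using h2_dist_h2_fun[OF ab(1,3)] ab by simp
  also have "\<dots> \<longleftrightarrow> (\<forall>n. a n = b n)"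
    by (subst suminf_eq_zero_iff[OF s]) auto
  also have "\<dots> \<longleftrightarrow> f = g"
    using inj_on_eq_iff[OF inj_on_h2_fun ab(1,3)] ab by (auto simp: fun_eq_iff)
  finally show "h2_dist f g = 0 \<longleftrightarrow> f = g" .
next
  fix f g h assume "f \<in> H2" "g \<in> H2" "h \<in> H2"
  then obtain a b c where abc: "a \<in> square_summable" "f = h2_fun a" "b \<in> square_summable"
      "g = h2_fun b" "c \<in> square_summable" "h = h2_fun c"
    by (auto simp: H2_def)
  have "h2_dist f h = sqrt (\<Sum>n. (cmod ((a n - b n) - (c n - b n)))\<^sup>2)"
    using h2_dist_h2_fun[OF abc(1,5)] abc by simp
  also have "\<dots> \<le> sqrt (\<Sum>n. (cmod (a n - b n))\<^sup>2) + sqrt (\<Sum>n. (cmod (c n - b n))\<^sup>2)"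
    by (rule l2_triangle[OF square_summable_diff[OF abc(1,3)] square_summable_diff[OF abc(5,3)]])
  also have "\<dots> = h2_dist f g + h2_dist g h"
    using h2_dist_h2_fun[OF abc(1,3)] h2_dist_h2_fun[OF abc(3,5)] abc by (simp add: norm_minus_commute)
  finally show "h2_dist f h \<le> h2_dist f g + h2_dist g h" .
qed

definition h2_compact_operator :: "((complex \<Rightarrow> complex) \<Rightarrow> (complex \<Rightarrow> complex)) \<Rightarrow> bool" where
  "h2_compact_operator T \<longleftrightarrow>
     T \<in> H2 \<rightarrow> H2 \<and>
     (\<forall>f\<in>H2. \<forall>g\<in>H2. \<forall>x y. T (\<lambda>s. x * f s + y * g s) = (\<lambda>s. x * T f s + y * T g s)) \<and>
     (\<forall>B. h2.mbounded B \<longrightarrow> compactin h2.mtopology (h2.mtopology closure_of (T ` B)))"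

subsection \<open>Symbols and composition operators\<close>

text \<open>The set of members of the class with characteristic \<open>c0\<close>. Since the series converges on
  \<open>Re s > 0\<close>, a symbol is identified with its extension \<open>c0 * s + dirichlet_series c s\<close> to that
  half-plane; its values elsewhere are irrelevant.\<close>

definition gordon_hedenmalm :: "nat \<Rightarrow> (complex \<Rightarrow> complex) set" where
  "gordon_hedenmalm c0 = {\<phi>.
     \<phi> ` right_halfplane (1/2) \<subseteq> right_halfplane (1/2) \<and>
     (\<exists>c. (\<forall>s\<in>right_halfplane 0. \<phi> s = of_nat c0 * s + dirichlet_series c s) \<and>
          (\<forall>\<epsilon>>0. uniform_limit (right_halfplane \<epsilon>)
             (\<lambda>N s. \<Sum>n=1..N. c n * of_nat n powr (- s)) (dirichlet_series c) sequentially) \<and>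
          (c0 = 0 \<longrightarrow> dirichlet_series c ` right_halfplane 0 \<subseteq> right_halfplane (1/2)) \<and>
          (c0 \<ge> 1 \<longrightarrow> (\<forall>s\<in>right_halfplane 0. dirichlet_series c s = 0) \<or>
             dirichlet_series c ` right_halfplane 0 \<subseteq> right_halfplane 0))}"

definition composition_operator ::
    "(complex \<Rightarrow> complex) \<Rightarrow> (complex \<Rightarrow> complex) \<Rightarrow> (complex \<Rightarrow> complex)" where
  "composition_operator \<phi> f = (\<lambda>s. if s \<in> right_halfplane (1/2) then f (\<phi> s) else 0)"

text \<open>Meant for \<open>\<phi> \<in> gordon_hedenmalm c0\<close>, where the real parts in question are bounded below.\<close>

definition unrestricted_range :: "nat \<Rightarrow> (complex \<Rightarrow> complex) \<Rightarrow> bool" where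
  "unrestricted_range c0 \<phi> \<longleftrightarrow>
     (INF s\<in>right_halfplane 0. Re (\<phi> s)) = (if c0 = 0 then 1/2 else 0)"

definition restricted_range :: "nat \<Rightarrow> (complex \<Rightarrow> complex) \<Rightarrow> bool" where
  "restricted_range c0 \<phi> \<longleftrightarrow> \<not> unrestricted_range c0 \<phi>"

end

theory Submission
  imports Defs "HOL-Complex_Analysis.Great_Picard"
begin

text \<open>
  \<^emph>\<open>Restricted range.\<close> If \<open>Re \<phi> \<ge> \<delta>\<close> on \<open>Re s > 0\<close> then the composition operator factors through
  the diagonal operator \<open>a n \<mapsto> n powr (-\<delta>) * a n\<close>: it is a contraction from the correspondingly
  weighted space. For a Dirichlet polynomial \<open>f\<close> the harmonic extension \<open>u\<close> of \<open>\<bar>f\<bar>^2\<close> from the imaginary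
  axis is explicit, with terms \<open>(n/m) powr (-w)\<close> for \<open>m \<le> n\<close> and their conjugates, and it dominates
  \<open>\<bar>f\<bar>^2\<close> on the half-plane. Since \<open>c0 \<ge> 1\<close>, the terms with \<open>m < n\<close> composed with \<open>\<phi>\<close> have only strictly
  positive frequencies, so the mean of \<open>u \<circ> \<phi>\<close> on vertical lines is the squared norm of \<open>f\<close>. Means are
  taken over arithmetic progressions with a generic step, which avoids integrals.

  \<^emph>\<open>Unrestricted range.\<close> Moving horizontally from points where \<open>Re \<phi>\<close> is small gives points \<open>w\<close> with
  \<open>Re w \<longlonglongrightarrow> 0\<close> and \<open>Re (\<phi> w) \<le> m * Re w\<close>. Restrict to frequencies in a finitely generated semigroup \<open>S\<close>
  containing those of \<open>\<phi>\<close>; its reproducing kernel at \<open>w\<close> has squared norm \<open>\<Sum>n\<in>S. n powr (-2 * Re w)\<close>,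
  which is doubling in \<open>Re w\<close> and tends to infinity. A norm limit of the images of normalised kernels at
  \<open>\<phi> w\<close> would pair with the normalised kernels at \<open>w\<close>, which tend weakly to \<open>0\<close>, in a quantity bounded
  below.
\<close>

subsection \<open>Discrete means\<close>

text \<open>\<open>E n k\<close> is \<open>(n/k) powr (-w)\<close>, so for k = 1 the right side is
  the explicit harmonic extension u at w. Harmonic function theory is bypassed by peeling off the
  lowest frequency: the rest is g * v with v the sum starting at k + 1 and |g| \<le> 1. Expanding
  |a_k + g v|^2 yields the cross terms of row k, and |g v|^2 \<le> |v|^2 feeds the
  induction.\<close>

lemma contraction_chain_bound:
  fixes a :: "nat \<Rightarrow> complex" and w :: complex
  defines "E \<equiv> \<lambda>n k. exp (- of_real (ln (real n) - ln (real k)) * w)"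
  assumes w: "0 \<le> Re w" and k: "1 \<le> k" "k \<le> N"
  shows "(cmod (\<Sum>n=k..N. a n * E n k))\<^sup>2 \<le>
    (\<Sum>n=k..N. (cmod (a n))\<^sup>2) + 2 * (\<Sum>m=k..N. \<Sum>n\<in>{m<..N}. Re (cnj (a m) * a n * E n m))"
  using k(2,1)
proof (induction rule: inc_induct)
  case base
  then show ?case by (simp add: E_def)
next
  case (step k)
  have E_self: "E n n = 1" for n by (simp add: E_def)
  define g where "g = E (Suc k) k"
  define v where "v = (\<Sum>n=Suc k..N. a n * E n (Suc k))"
  have E_Suc: "E n k = g * E n (Suc k)" for n
    by (simp add: E_def g_def flip: exp_add) (simp add: algebra_simps)
  have set1: "{k..N} = insert k {Suc k..N}" "{k<..N} = {Suc k..N}" using step.hyps by auto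
  have split: "(\<Sum>n=k..N. f n) = f k + (\<Sum>n=Suc k..N. f n)" for f :: "nat \<Rightarrow> real"
    by (simp add: set1(1))
  have v_eq: "(\<Sum>n\<in>{k<..N}. a n * E n k) = g * v"
    by (simp add: set1 v_def E_Suc sum_distrib_left mult_ac)
  have lhs: "(\<Sum>n=k..N. a n * E n k) = a k + g * v"
    using v_eq by (simp add: set1 E_self)
  \<comment> \<open>The half-plane condition on w enters here: g is
    \<open>((k+1)/k) powr (-w)\<close>.\<close>
  have "cmod g \<le> 1"
    using w step.prems by (simp add: g_def E_def mult_nonpos_nonneg)
  then have gv: "(cmod (g * v))\<^sup>2 \<le> (cmod v)\<^sup>2"
    by (intro power_mono) (auto simp: norm_mult mult_left_le_one_le)
  have row: "(\<Sum>n\<in>{k<..N}. Re (cnj (a k) * a n * E n k)) = Re (cnj (a k) * (g * v))"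
    by (simp only: v_eq[symmetric] sum_distrib_left Re_sum mult.assoc)
  have sq: "(cmod (a k + g * v))\<^sup>2 = (cmod (a k))\<^sup>2 + 2 * Re (cnj (a k) * (g * v)) + (cmod (g * v))\<^sup>2"
    by (simp only: cmod_power2) (simp add: power2_eq_square algebra_simps)
  have IH: "(cmod v)\<^sup>2 \<le> (\<Sum>n=Suc k..N. (cmod (a n))\<^sup>2) +
      2 * (\<Sum>m=Suc k..N. \<Sum>n\<in>{m<..N}. Re (cnj (a m) * a n * E n m))"
    using step.IH step.prems by (simp add: v_def)
  have arith: "A + 2 * R + G \<le> A + X + 2 * (R + Y)" if "G \<le> V" "V \<le> X + 2 * Y"
    for A R G V X Y :: real
    using that by argo
  show ?case
    unfolding lhs sq split row by (rule arith[OF gv IH])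
qed

text \<open>For z \<noteq> 1 the geometric sums stay bounded by 2 / |z - 1|, so division by K sends
  them to 0.\<close>

lemma average_powers_tendsto:
  fixes z :: complex
  assumes "cmod z = 1"
  shows "(\<lambda>K. (\<Sum>j<K. z ^ j) / of_nat K) \<longlonglongrightarrow> (if z = 1 then 1 else 0)"
proof (cases "z = 1")
  case True
  have "(\<lambda>K. (\<Sum>j<K. z ^ j) / of_nat K) \<longlonglongrightarrow> 1"
    by (rule tendsto_eventually, rule eventually_mono[OF eventually_gt_at_top[of 0]]) (simp add: True)
  then show ?thesis using True by simp
next
  case False
  have "(\<lambda>K. (\<Sum>j<K. z ^ j) / of_nat K) \<longlonglongrightarrow> 0"
  proof (rule Lim_null_comparison)
    show "(\<lambda>K. (2 / cmod (z - 1)) / real K) \<longlonglongrightarrow> 0" using lim_const_over_n by blast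
    show "\<forall>\<^sub>F K in sequentially. cmod ((\<Sum>j<K. z ^ j) / of_nat K) \<le> (2 / cmod (z - 1)) / real K"
    proof (rule always_eventually, rule allI)
      fix K
      have "cmod (z ^ K - 1) \<le> cmod (z ^ K) + 1" by (rule order_trans[OF norm_triangle_ineq4]) simp
      then have "cmod (z ^ K - 1) \<le> 2" using assms by (simp add: norm_power)
      then show "cmod ((\<Sum>j<K. z ^ j) / of_nat K) \<le> (2 / cmod (z - 1)) / real K"
        using False by (simp add: sum_gp_strict norm_divide norm_mult norm_minus_commute divide_right_mono)
    qed
  qed
  then show ?thesis using False by simp
qed

text \<open>Tannery's theorem with majorant |\<beta> k| exchanges the mean over j with the sum over
  k; only the terms without rotation survive.\<close>

lemma average_series_tendsto:
  fixes \<beta> z :: "nat \<Rightarrow> complex"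
  assumes \<beta>: "summable (\<lambda>k. cmod (\<beta> k))" and z: "\<And>k. cmod (z k) = 1"
  shows "(\<lambda>K. (\<Sum>j<K. \<Sum>k. \<beta> k * z k ^ j) / of_nat K) \<longlonglongrightarrow> (\<Sum>k. if z k = 1 then \<beta> k else 0)"
proof -
  have sm: "summable (\<lambda>k. \<beta> k * z k ^ j)" for j
    by (rule summable_norm_cancel) (simp add: norm_mult norm_power z \<beta>)
  have "(\<Sum>j<K. \<Sum>k. \<beta> k * z k ^ j) / of_nat K = (\<Sum>k. \<beta> k * ((\<Sum>j<K. z k ^ j) / of_nat K))" for K
    by (simp add: suminf_sum[symmetric] sm suminf_divide[symmetric] summable_sum sum_distrib_left)
  moreover have "(\<lambda>K. (\<Sum>k. \<beta> k * ((\<Sum>j<K. z k ^ j) / of_nat K)))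
      \<longlonglongrightarrow> (\<Sum>k. \<beta> k * (if z k = 1 then 1 else 0))"
  proof (rule conjunct2[OF conjunct2[OF tannerys_theorem[OF _ _ \<beta>]]])
    show "(\<lambda>K. \<beta> k * ((\<Sum>j<K. z k ^ j) / of_nat K)) \<longlonglongrightarrow> \<beta> k * (if z k = 1 then 1 else 0)" for k
      by (intro tendsto_mult_left average_powers_tendsto z)
    have "cmod (\<beta> k * ((\<Sum>j<K. z k ^ j) / of_nat K)) \<le> cmod (\<beta> k)" for k K
    proof -
      have "cmod (\<Sum>j<K. z k ^ j) \<le> (\<Sum>j<K. cmod (z k ^ j))" by (rule norm_sum)
      then have "cmod (\<Sum>j<K. z k ^ j) \<le> real K" by (simp add: norm_power z)
      then have "cmod ((\<Sum>j<K. z k ^ j) / of_nat K) \<le> 1" by (simp add: norm_divide divide_le_eq)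
      then show ?thesis by (simp only: norm_mult) (simp add: mult_left_le)
    qed
    then show "\<forall>\<^sub>F (k, K) in sequentially \<times>\<^sub>F sequentially.
        cmod (\<beta> k * ((\<Sum>j<K. z k ^ j) / of_nat K)) \<le> cmod (\<beta> k)"
      by (intro always_eventually) auto
  qed simp
  ultimately show ?thesis by (simp add: if_distrib[of "\<lambda>x. _ * x"] cong: if_cong)
qed

text \<open>A step for which sampling along \<open>\<sigma> + i \<tau> j\<close> sees no resonance between rational frequencies.\<close>

lemma generic_step:
  obtains \<tau> :: real where "\<And>q. q \<in> \<rat> \<Longrightarrow> 0 < q \<Longrightarrow> cis (\<tau> * ln q) = 1 \<Longrightarrow> q = 1"
proof -
  \<comment> \<open>A resonance of q with i full turns forces \<tau> to be one specific value. Only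
    countably many pairs (q, i) exist, so some real \<tau> avoids them all.\<close>
  define Bad where "Bad = (\<lambda>(q, i). 2 * pi * real_of_int i / ln q) ` ((\<rat> :: real set) \<times> (UNIV :: int set))"
  have "countable Bad" unfolding Bad_def
    by (intro countable_image countable_SIGMA countable_rat) auto
  then have "Bad \<noteq> UNIV" using uncountable_UNIV_real by auto
  then obtain \<tau> where \<tau>: "\<tau> \<notin> Bad" by auto
  show ?thesis
  proof
    fix q :: real assume q: "q \<in> \<rat>" "0 < q" "cis (\<tau> * ln q) = 1"
    show "q = 1"
    proof (rule ccontr)
      assume "q \<noteq> 1"
      then have ln: "ln q \<noteq> 0" using q by simp
      have "cos (\<tau> * ln q) = 1" using q(3) by (auto simp: complex_eq_iff)
      then obtain i :: int where "\<tau> * ln q = i * 2 * pi" using cos_one_2pi_int by auto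
      then have "\<tau> = 2 * pi * i / ln q" using ln by (simp add: field_simps)
      then have "\<tau> \<in> Bad" using q(1) unfolding Bad_def by (intro image_eqI[of _ _ "(q, i)"]) auto
      then show False using \<tau> by simp
    qed
  qed
qed

subsection \<open>Dirichlet series converging absolutely everywhere\<close>

text \<open>Two instances matter: all positive integers for the compactness direction, and a
  finitely generated semigroup for the converse, where the reproducing kernels must exist up to the
  imaginary axis.\<close>

locale mult_semigroup =
  fixes S :: "nat set"
  assumes pos: "n \<in> S \<Longrightarrow> 0 < n"
    and one_mem: "1 \<in> S"
    and mult_mem: "m \<in> S \<Longrightarrow> n \<in> S \<Longrightarrow> m * n \<in> S"
begin

lemma power_mem: "n \<in> S \<Longrightarrow> n ^ k \<in> S"
  by (induction k) (auto intro: one_mem[simplified] mult_mem)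

end

text \<open>Over the complex numbers \<open>has_sum\<close> is absolute, so these Dirichlet series converge absolutely
  on the whole plane.\<close>

definition entire_dirichlet :: "nat set \<Rightarrow> (nat \<Rightarrow> complex) \<Rightarrow> (complex \<Rightarrow> complex) \<Rightarrow> bool" where
  "entire_dirichlet S b F \<longleftrightarrow> (\<forall>k. k \<notin> S \<longrightarrow> b k = 0) \<and>
     (\<forall>s. ((\<lambda>k. b k * of_nat k powr (- s)) has_sum F s) UNIV)"

lemma has_sum_times:
  fixes f :: "'a \<Rightarrow> complex" and g :: "'b \<Rightarrow> complex"
  assumes f: "(f has_sum a) A" and g: "(g has_sum b) B"
  shows "((\<lambda>(x, y). f x * g y) has_sum a * b) (A \<times> B)"
proof (rule has_sum_SigmaI)
  show "((\<lambda>y. case (x, y) of (x, y) \<Rightarrow> f x * g y) has_sum f x * b) B" for x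
    using has_sum_cmult_right[OF g] by simp
  show "((\<lambda>x. f x * b) has_sum a * b) A" using has_sum_cmult_left[OF f] .
  have fn: "(\<lambda>x. cmod (f x)) summable_on A" and gn: "(\<lambda>y. cmod (g y)) summable_on B"
    using f g by (auto simp: summable_on_iff_abs_summable_on_complex[symmetric] intro: has_sum_imp_summable)
  have "(\<lambda>z. cmod (case z of (x, y) \<Rightarrow> f x * g y)) summable_on A \<times> B"
  proof (rule summable_on_SigmaI)
    show "((\<lambda>y. cmod (case (x, y) of (x, y) \<Rightarrow> f x * g y)) has_sum
        cmod (f x) * (\<Sum>\<^sub>\<infinity>y\<in>B. cmod (g y))) B" for x
      using has_sum_cmult_right[OF has_sum_infsum[OF gn]] by (simp add: norm_mult)
    show "(\<lambda>x. cmod (f x) * (\<Sum>\<^sub>\<infinity>y\<in>B. cmod (g y))) summable_on A"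
      by (rule summable_on_cmult_left[OF fn])
  qed auto
  then show "(\<lambda>(x, y). f x * g y) summable_on A \<times> B"
    by (simp add: summable_on_iff_abs_summable_on_complex)
qed

lemma of_nat_mult_powr: "of_nat (m * n) powr (s :: complex) = of_nat m powr s * of_nat n powr s"
  using powr_times_real[of "of_nat m" "of_nat n" s] by simp

lemma of_nat_power_powr: "0 < n \<Longrightarrow> of_nat (n ^ j) powr (s :: complex) = (of_nat n powr s) ^ j"
  by (induction j) (auto simp: of_nat_mult_powr simp del: of_nat_mult of_nat_power)

lemma entire_dirichlet_add:
  assumes "entire_dirichlet S b F" "entire_dirichlet S d G"
  shows "entire_dirichlet S (\<lambda>k. b k + d k) (\<lambda>s. F s + G s)"
  using assms unfolding entire_dirichlet_def
  by (auto simp: distrib_right intro: has_sum_add)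

lemma entire_dirichlet_cmult:
  assumes "entire_dirichlet S b F"
  shows "entire_dirichlet S (\<lambda>k. z * b k) (\<lambda>s. z * F s)"
  using assms unfolding entire_dirichlet_def
  by (auto simp: mult.assoc intro: has_sum_cmult_right)

lemma entire_dirichlet_zero: "entire_dirichlet S (\<lambda>k. 0) (\<lambda>s. 0)"
  by (simp add: entire_dirichlet_def has_sum_0)

lemma entire_dirichlet_sum:
  assumes "\<And>i. i \<in> I \<Longrightarrow> entire_dirichlet S (b i) (F i)"
  shows "entire_dirichlet S (\<lambda>k. \<Sum>i\<in>I. b i k) (\<lambda>s. \<Sum>i\<in>I. F i s)"
  using assms
  by (induction I rule: infinite_finite_induct)
    (auto simp: entire_dirichlet_zero intro: entire_dirichlet_add)

lemma entire_dirichlet_monom: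
  assumes "n \<in> S"
  shows "entire_dirichlet S (\<lambda>k. if k = n then 1 else 0) (\<lambda>s. of_nat n powr (- s))"
  unfolding entire_dirichlet_def
proof (intro conjI allI impI)
  fix s :: complex
  show "((\<lambda>k. (if k = n then 1 else 0) * of_nat k powr (- s)) has_sum of_nat n powr (- s)) UNIV"
    by (rule has_sum_finite_neutralI[of "{n}"]) auto
qed (use assms in auto)

context mult_semigroup
begin

text \<open>The coefficients are the Dirichlet convolution. Absolute convergence permits regrouping
  the double series by the product of the indices, and closure of S under multiplication keeps the
  support in S.\<close>

lemma entire_dirichlet_mult:
  assumes b: "entire_dirichlet S b F" and d: "entire_dirichlet S d G"
  obtains e where "entire_dirichlet S e (\<lambda>s. F s * G s)"
proof
  \<comment> \<open>Since 0 is not in S, \<open>D 0\<close> is empty and every other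
    \<open>D m\<close> is a finite set of factorisations.\<close>
  define D where "D = (\<lambda>m. {(i, j). i \<in> S \<and> j \<in> S \<and> i * j = m})"
  define e where "e = (\<lambda>m. \<Sum>(i, j)\<in>D m. b i * d j)"
  have finD: "finite (D m)" for m
  proof (cases "m = 0")
    case True
    then have "D m = {}" by (auto simp: D_def dest!: pos)
    then show ?thesis by simp
  next
    case False
    then have "D m \<subseteq> {..m} \<times> {..m}" by (auto simp: D_def)
    then show ?thesis by (rule finite_subset) auto
  qed
  have supp: "e k = 0" if "k \<notin> S" for k
  proof -
    have "D k = {}" using that by (auto simp: D_def intro: mult_mem)
    then show ?thesis by (simp add: e_def)
  qed
  have onS: "((\<lambda>k. c k * of_nat k powr (- s)) has_sum H s) S"
    if "entire_dirichlet S c H" for c H s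
    using that unfolding entire_dirichlet_def
    by (subst has_sum_cong_neutral[where T = UNIV]) auto
  have "((\<lambda>k. e k * of_nat k powr (- s)) has_sum F s * G s) UNIV" for s
  proof -
    define T where "T = (\<lambda>(i, j). (b i * of_nat i powr (- s)) * (d j * of_nat j powr (- s)))"
    have "(T has_sum F s * G s) (S \<times> S)"
      unfolding T_def by (rule has_sum_times[OF onS[OF b] onS[OF d]])
    \<comment> \<open>Each pair (i, j) lies over exactly one m, namely its product.\<close>
    moreover have "bij_betw snd (Sigma UNIV D) (S \<times> S)"
      by (rule bij_betwI[of _ _ _ "\<lambda>(i, j). (i * j, i, j)"]) (auto simp: D_def)
    ultimately have "((\<lambda>x. T (snd x)) has_sum F s * G s) (Sigma UNIV D)"
      using has_sum_reindex_bij_betw by blast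
    moreover have "((\<lambda>y. T (snd (k, y))) has_sum e k * of_nat k powr (- s)) (D k)" for k
    proof (rule has_sum_finiteI[OF finD])
      show "e k * of_nat k powr (- s) = (\<Sum>y\<in>D k. T (snd (k, y)))"
        unfolding e_def sum_distrib_right
        by (rule sum.cong) (auto simp: T_def D_def of_nat_mult_powr simp del: of_nat_mult)
    qed
    ultimately show ?thesis by (rule has_sum_SigmaD)
  qed
  with supp show "entire_dirichlet S e (\<lambda>s. F s * G s)" by (simp add: entire_dirichlet_def)
qed

text \<open>The exponential series in y * n^(-s) is already a Dirichlet series, supported on the
  powers of n.\<close>

lemma entire_dirichlet_exp_monom:
  assumes n: "n \<in> S" "2 \<le> n"
  obtains b where "entire_dirichlet S b (\<lambda>s. exp (y * of_nat n powr (- s)))"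
proof
  \<comment> \<open>The exponent j with k = n ^ j is unique because 2 \<le> n, so the description
    operator is well determined on the range.\<close>
  define b where "b = (\<lambda>k. if k \<in> range (power n) then y ^ (THE j. k = n ^ j) / fact (THE j. k = n ^ j) else 0)"
  have inj: "inj (power n)" using n(2) by (auto simp: inj_def)
  have b_pow: "b (n ^ j) = y ^ j / fact j" for j
  proof -
    have "(THE i. n ^ j = n ^ i) = j" using n(2) by (intro the_equality) auto
    then show ?thesis by (simp add: b_def)
  qed
  show "entire_dirichlet S b (\<lambda>s. exp (y * of_nat n powr (- s)))"
    unfolding entire_dirichlet_def
  proof (intro conjI allI impI)
    show "b k = 0" if "k \<notin> S" for k using that power_mem[OF n(1)] by (auto simp: b_def)
    fix s :: complex
    let ?x = "y * of_nat n powr (- s)"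
    have "((\<lambda>j. ?x ^ j /\<^sub>R fact j) has_sum exp ?x) UNIV"
      by (rule norm_summable_imp_has_sum[OF summable_norm_exp exp_converges])
    also have "(\<lambda>j. ?x ^ j /\<^sub>R fact j) = (\<lambda>k. b k * of_nat k powr (- s)) \<circ> power n"
    proof
      fix j
      show "?x ^ j /\<^sub>R fact j = ((\<lambda>k. b k * of_nat k powr (- s)) \<circ> power n) j"
        using n(2) by (simp add: b_pow of_nat_power_powr power_mult_distrib scaleR_conv_of_real divide_simps
            del: of_nat_power)
    qed
    finally have "((\<lambda>k. b k * of_nat k powr (- s)) has_sum exp ?x) (range (power n))"
      by (subst has_sum_reindex[OF inj])
    also have "?this \<longleftrightarrow> ((\<lambda>k. b k * of_nat k powr (- s)) has_sum exp ?x) UNIV"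
      by (rule has_sum_cong_neutral) (auto simp: b_def)
    finally show "((\<lambda>k. b k * of_nat k powr (- s)) has_sum exp ?x) UNIV" .
  qed
qed

lemma entire_dirichlet_exp_poly:
  assumes "finite I" "\<And>n. n \<in> I \<Longrightarrow> n \<in> S \<and> 2 \<le> n"
  obtains b where "entire_dirichlet S b (\<lambda>s. exp (z + (\<Sum>n\<in>I. y n * of_nat n powr (- s))))"
  using assms
proof (induction I arbitrary: thesis rule: finite_induct)
  case empty
  have "entire_dirichlet S (\<lambda>k. exp z * (if k = 1 then 1 else 0)) (\<lambda>s. exp z * of_nat 1 powr (- s))"
    by (rule entire_dirichlet_cmult[OF entire_dirichlet_monom[OF one_mem]])
  then show ?case using empty.prems(1) by simp
next
  case (insert m I)
  obtain b where b: "entire_dirichlet S b (\<lambda>s. exp (z + (\<Sum>n\<in>I. y n * of_nat n powr (- s))))"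
    using insert.IH insert.prems(2) by blast
  obtain d where d: "entire_dirichlet S d (\<lambda>s. exp (y m * of_nat m powr (- s)))"
    using entire_dirichlet_exp_monom[of m "y m"] insert.prems(2) by blast
  obtain e where e: "entire_dirichlet S e (\<lambda>s. exp (z + (\<Sum>n\<in>I. y n * of_nat n powr (- s))) *
      exp (y m * of_nat m powr (- s)))"
    using entire_dirichlet_mult[OF b d] by blast
  also have "(\<lambda>s. exp (z + (\<Sum>n\<in>I. y n * of_nat n powr (- s))) * exp (y m * of_nat m powr (- s))) =
      (\<lambda>s. exp (z + (\<Sum>n\<in>insert m I. y n * of_nat n powr (- s))))"
    using insert.hyps by (simp add: fun_eq_iff algebra_simps flip: exp_add)
  finally show ?case using insert.prems(1) by blast
qed

end

subsection \<open>Contractivity on Dirichlet polynomials\<close>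

lemma of_nat_powr_complex: "0 < n \<Longrightarrow> of_nat n powr (s :: complex) = exp (s * of_real (ln (real n)))"
  using Ln_of_real[of "real n"] by (simp add: powr_def)

lemma cis_power: "cis x ^ j = cis (real j * x)"
  by (rule Complex.DeMoivre)

context mult_semigroup
begin

text \<open>Extraction of a Fourier coefficient on the line Re s = \<sigma>: genericity of \<tau>
  leaves only the frequency k = q. The frequency q ranges over positive rationals so that
  non-integral q, for which the mean is 0, are covered as well.\<close>

lemma average_entire_dirichlet:
  fixes q \<tau> \<sigma> :: real
  assumes F: "entire_dirichlet S b F"
    and \<tau>: "\<And>q. q \<in> \<rat> \<Longrightarrow> 0 < q \<Longrightarrow> cis (\<tau> * ln q) = 1 \<Longrightarrow> q = 1"
    and q: "q \<in> \<rat>" "0 < q"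
  shows "(\<lambda>K. (\<Sum>j<K. cis (real j * (\<tau> * ln q)) * F (Complex \<sigma> (\<tau> * real j))) / of_nat K)
    \<longlonglongrightarrow> (\<Sum>k. if real k = q then b k * of_nat k powr (- of_real \<sigma>) else 0)"
proof -
  define \<beta> where "\<beta> = (\<lambda>k. b k * of_nat k powr (- of_real \<sigma>))"
  \<comment> \<open>\<open>z k\<close> is the rotation of the k-th term over one sampling step; it
    equals 1 only if q / k = 1.\<close>
  define z where "z = (\<lambda>k. cis (\<tau> * ln (q / real k)))"
  have b0: "b 0 = 0" using F pos[of 0] by (auto simp: entire_dirichlet_def)
  have F_sum: "((\<lambda>k. b k * of_nat k powr (- s)) has_sum F s) UNIV" for s
    using F by (simp add: entire_dirichlet_def)
  have "(\<lambda>k. cmod (\<beta> k)) summable_on UNIV"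
    unfolding \<beta>_def summable_on_iff_abs_summable_on_complex[symmetric]
    by (rule has_sum_imp_summable[OF F_sum])
  then have \<beta>: "summable (\<lambda>k. cmod (\<beta> k))"
    by (rule summable_on_imp_summable)
  have "cis (real j * (\<tau> * ln q)) * F (Complex \<sigma> (\<tau> * real j)) = (\<Sum>k. \<beta> k * z k ^ j)" for j
  proof -
    have "(\<lambda>k. cis (real j * (\<tau> * ln q)) * (b k * of_nat k powr (- Complex \<sigma> (\<tau> * real j)))) sums
        (cis (real j * (\<tau> * ln q)) * F (Complex \<sigma> (\<tau> * real j)))"
      by (intro has_sum_imp_sums has_sum_cmult_right F_sum)
    moreover have "cis (real j * (\<tau> * ln q)) * (b k * of_nat k powr (- Complex \<sigma> (\<tau> * real j))) = \<beta> k * z k ^ j"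
      for k
    proof (cases "k = 0")
      case False
      have zk: "z k ^ j = cis (real j * (\<tau> * ln q - \<tau> * ln (real k)))"
        using False q(2) by (simp add: z_def cis_power ln_div right_diff_distrib)
      have "cis (real j * (\<tau> * ln q)) * of_nat k powr (- Complex \<sigma> (\<tau> * real j)) =
          of_nat k powr (- of_real \<sigma>) * z k ^ j"
        using False zk
        by (simp add: of_nat_powr_complex cis_conv_exp flip: exp_add)
          (simp add: Complex_eq algebra_simps)
      then show ?thesis by (simp add: \<beta>_def mult_ac)
    qed (simp add: b0 \<beta>_def)
    ultimately show ?thesis by (simp add: sums_iff)
  qed
  moreover have "(if z k = 1 then \<beta> k else 0) = (if real k = q then b k * of_nat k powr (- of_real \<sigma>) else 0)" for k
  proof (cases "k = 0")
    case False
    then have "z k = 1 \<longleftrightarrow> real k = q"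
      using \<tau>[of "q / real k"] q by (auto simp: z_def)
    then show ?thesis by (simp add: \<beta>_def)
  qed (simp add: b0 \<beta>_def)
  ultimately show ?thesis
    using average_series_tendsto[OF \<beta>, of z] by (simp add: z_def)
qed

text \<open>A Bessel inequality. With P the part of F on the frequencies in G, expanding |F - P|^2
  \<ge> 0 gives 2 Re (F cnj P) - |P|^2 \<le> |F|^2 \<le> h, and the left side has mean 2 V - V = V.
  This avoids computing the mean of |F|^2: any majorant h with known mean suffices.\<close>

lemma average_square_ge:
  fixes h :: "nat \<Rightarrow> real"
  assumes F: "entire_dirichlet S b F"
    and \<tau>: "\<And>q. q \<in> \<rat> \<Longrightarrow> 0 < q \<Longrightarrow> cis (\<tau> * ln q) = 1 \<Longrightarrow> q = 1"
    and h: "\<And>j. (cmod (F (Complex \<sigma> (\<tau> * real j))))\<^sup>2 \<le> h j"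
    and L: "(\<lambda>K. (\<Sum>j<K. h j) / real K) \<longlonglongrightarrow> L"
    and G: "finite G" "G \<subseteq> S"
  shows "(\<Sum>k\<in>G. (cmod (b k))\<^sup>2 * real k powr (- 2 * \<sigma>)) \<le> L"
proof -
  define s where "s = (\<lambda>j. Complex \<sigma> (\<tau> * real j))"
  define P where "P = (\<lambda>s. \<Sum>l\<in>G. b l * of_nat l powr (- s))"
  define p where "p = (\<lambda>k. \<Sum>l\<in>G. b l * (if k = l then 1 else 0))"
  define V where "V = (\<Sum>k\<in>G. (cmod (b k))\<^sup>2 * real k powr (- 2 * \<sigma>))"
  have P: "entire_dirichlet S p P"
    unfolding P_def p_def using G
    by (intro entire_dirichlet_sum entire_dirichlet_cmult entire_dirichlet_monom) auto
  have p_eq: "p l = b l" if "l \<in> G" for l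
    using that G(1) by (simp add: p_def if_distrib cong: if_cong)
  have cnj_P: "cnj (P (s j)) = (\<Sum>l\<in>G. cnj (b l) * of_real (real l powr - \<sigma>) * cis (real j * (\<tau> * ln (real l))))"
    for j
  proof -
    have "cnj (of_nat l powr (- s j)) = of_real (real l powr - \<sigma>) * cis (real j * (\<tau> * ln (real l)))"
      if "l \<in> G" for l
    proof -
      have "0 < l" using that G(2) pos by auto
      then show ?thesis
        by (simp add: of_nat_powr_complex s_def powr_def cis_conv_exp exp_cnj flip: exp_of_real exp_add)
          (simp add: Complex_eq algebra_simps)
    qed
    then show ?thesis by (simp add: P_def mult.assoc cong: sum.cong)
  qed
  \<comment> \<open>Applied once to F and once to P itself; both have the coefficients b on
    G.\<close>
  have avg: "(\<lambda>K. (\<Sum>j<K. H (s j) * cnj (P (s j))) / of_nat K) \<longlonglongrightarrow> of_real V"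
    if H: "entire_dirichlet S d H" and d: "\<And>l. l \<in> G \<Longrightarrow> d l = b l" for d H
  proof -
    have "(\<lambda>K. \<Sum>l\<in>G. cnj (b l) * of_real (real l powr - \<sigma>) *
          ((\<Sum>j<K. cis (real j * (\<tau> * ln (real l))) * H (s j)) / of_nat K))
        \<longlonglongrightarrow> (\<Sum>l\<in>G. cnj (b l) * of_real (real l powr - \<sigma>) *
          (\<Sum>k. if real k = real l then d k * of_nat k powr (- of_real \<sigma>) else 0))"
      unfolding s_def
    proof (intro tendsto_sum tendsto_mult_left average_entire_dirichlet[OF H \<tau>])
      show "0 < real l" if "l \<in> G" for l using that G(2) pos by auto
    qed auto
    moreover have "(\<Sum>l\<in>G. cnj (b l) * of_real (real l powr - \<sigma>) *
          ((\<Sum>j<K. cis (real j * (\<tau> * ln (real l))) * H (s j)) / of_nat K)) =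
        (\<Sum>j<K. H (s j) * cnj (P (s j))) / of_nat K" for K
      unfolding cnj_P sum_distrib_left sum_divide_distrib
      by (subst sum.swap) (simp add: mult_ac)
    moreover have "(\<Sum>l\<in>G. cnj (b l) * of_real (real l powr - \<sigma>) *
          (\<Sum>k. if real k = real l then d k * of_nat k powr (- of_real \<sigma>) else 0)) = of_real V"
      unfolding V_def of_real_sum
    proof (rule sum.cong[OF refl])
      fix l assume l: "l \<in> G"
      then have "0 < l" using G(2) pos by auto
      have "(\<Sum>k. if real k = real l then d k * of_nat k powr (- of_real \<sigma>) else 0) = b l * of_real (real l powr - \<sigma>)"
        using suminf_finite[of "{l}" "\<lambda>k. if k = l then d k * of_nat k powr (- of_real \<sigma>) else 0"] \<open>0 < l\<close>
        by (simp add: d[OF l] of_nat_powr_complex powr_def flip: exp_of_real)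
      moreover have "real l powr (- 2 * \<sigma>) = real l powr - \<sigma> * real l powr - \<sigma>"
        by (simp flip: powr_add)
      ultimately show "cnj (b l) * of_real (real l powr - \<sigma>) *
          (\<Sum>k. if real k = real l then d k * of_nat k powr (- of_real \<sigma>) else 0) =
          of_real ((cmod (b l))\<^sup>2 * real l powr (- 2 * \<sigma>))"
        by (simp add: complex_norm_square mult_ac del: of_real_power)
    qed
    ultimately show ?thesis by simp
  qed
  have "(\<lambda>K. 2 * Re ((\<Sum>j<K. F (s j) * cnj (P (s j))) / of_nat K) - Re ((\<Sum>j<K. P (s j) * cnj (P (s j))) / of_nat K))
      \<longlonglongrightarrow> 2 * Re (of_real V) - Re (of_real V)"
    by (intro tendsto_intros avg[OF F] avg[OF P] p_eq refl)
  then have "(\<lambda>K. 2 * Re ((\<Sum>j<K. F (s j) * cnj (P (s j))) / of_nat K) - Re ((\<Sum>j<K. P (s j) * cnj (P (s j))) / of_nat K))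
      \<longlonglongrightarrow> V" by simp
  moreover have "2 * Re ((\<Sum>j<K. F (s j) * cnj (P (s j))) / of_nat K) - Re ((\<Sum>j<K. P (s j) * cnj (P (s j))) / of_nat K)
      \<le> (\<Sum>j<K. h j) / real K" for K
  proof -
    have "2 * Re (x * cnj y) - Re (y * cnj y) \<le> (cmod x)\<^sup>2" for x y
    proof -
      have "0 \<le> (cmod (x - y))\<^sup>2" by simp
      then show ?thesis by (simp only: cmod_power2) (simp add: power2_eq_square algebra_simps)
    qed
    then have "2 * Re (F (s j) * cnj (P (s j))) - Re (P (s j) * cnj (P (s j))) \<le> h j" for j
      using h[of j] order_trans unfolding s_def by blast
    then have "(\<Sum>j<K. 2 * Re (F (s j) * cnj (P (s j))) - Re (P (s j) * cnj (P (s j)))) \<le> (\<Sum>j<K. h j)"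
      by (rule sum_mono)
    then have "(\<Sum>j<K. 2 * Re (F (s j) * cnj (P (s j))) - Re (P (s j) * cnj (P (s j)))) / real K \<le> (\<Sum>j<K. h j) / real K"
      by (rule divide_right_mono) simp
    moreover have "Re (x / of_nat K) = Re x / real K" for x
      using Re_divide_of_real[of x "real K"] by simp
    ultimately show ?thesis
      by (simp only: sum_subtractf sum_distrib_left[symmetric] Re_sum diff_divide_distrib)
  qed
  ultimately show ?thesis
    unfolding V_def[symmetric] using L by (intro LIMSEQ_le) auto
qed

end

text \<open>Requiring the frequencies of the symbol to lie in S makes composition preserve series
  supported in S.\<close>

locale polynomial_symbol = mult_semigroup +
  fixes c0 N :: nat and c :: "nat \<Rightarrow> complex" and \<phi> :: "complex \<Rightarrow> complex"
  assumes symbol: "\<phi> s = of_nat c0 * s + c 1 + (\<Sum>n=2..N. c n * of_nat n powr (- s))"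
    and char: "1 \<le> c0"
    and frequencies: "{2..N} \<subseteq> S"
begin

text \<open>Removing the linear term leaves a Dirichlet polynomial, whose exponential is covered by
  \<open>entire_dirichlet_exp_poly\<close>. The shift z later takes the values 0 and
  \<delta>.\<close>

lemma entire_dirichlet_exp_symbol:
  obtains b where "entire_dirichlet S b (\<lambda>s. exp (x * (\<phi> s - of_nat c0 * s - z)))"
proof -
  obtain b where "entire_dirichlet S b
      (\<lambda>s. exp (x * (c 1 - z) + (\<Sum>n=2..N. (x * c n) * of_nat n powr (- s))))"
  proof (rule entire_dirichlet_exp_poly[of "{2..N}" "x * (c 1 - z)" "\<lambda>n. x * c n"])
    show "n \<in> S \<and> 2 \<le> n" if "n \<in> {2..N}" for n using that frequencies by auto
  qed auto
  also have "(\<lambda>s. x * (c 1 - z) + (\<Sum>n=2..N. (x * c n) * of_nat n powr (- s))) =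
      (\<lambda>s. x * (\<phi> s - of_nat c0 * s - z))"
    by (simp add: symbol fun_eq_iff algebra_simps sum_distrib_left)
  finally show ?thesis using that by blast
qed

text \<open>The linear term of \<phi> contributes the monomial of frequency n ^ c0, which lies in S;
  the remaining factor is the exponential of a Dirichlet polynomial.\<close>

lemma entire_dirichlet_powr_symbol:
  assumes "n \<in> S"
  obtains b where "entire_dirichlet S b (\<lambda>s. of_nat n powr (- \<phi> s))"
proof -
  obtain b where b: "entire_dirichlet S b (\<lambda>s. exp (- of_real (ln (real n)) * (\<phi> s - of_nat c0 * s - 0)))"
    using entire_dirichlet_exp_symbol by blast
  obtain e where "entire_dirichlet S e (\<lambda>s. exp (- of_real (ln (real n)) * (\<phi> s - of_nat c0 * s - 0)) *
      of_nat (n ^ c0) powr (- s))"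
    using entire_dirichlet_mult[OF b entire_dirichlet_monom[OF power_mem[OF assms]]] by blast
  also have "(\<lambda>s. exp (- of_real (ln (real n)) * (\<phi> s - of_nat c0 * s - 0)) * of_nat (n ^ c0) powr (- s)) =
      (\<lambda>s. of_nat n powr (- \<phi> s))"
  proof
    fix s
    have "ln (real (n ^ c0)) = real c0 * ln (real n)"
      using pos[OF assms] by (simp add: ln_realpow)
    then show "exp (- of_real (ln (real n)) * (\<phi> s - of_nat c0 * s - 0)) * of_nat (n ^ c0) powr (- s) =
        of_nat n powr (- \<phi> s)"
      using pos[OF assms]
      by (simp add: of_nat_powr_complex algebra_simps del: of_nat_power flip: exp_add)
  qed
  finally show ?thesis using that by blast
qed

text \<open>Passing from \<phi> to \<phi> - \<delta> moves the weights n^(-\<delta>) into the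
  coefficients a' while keeping the real part nonnegative. \<open>contraction_chain_bound\<close>
  then supplies the majorant h for \<open>average_square_ge\<close>, and the mean of h is its
  constant part because the cross terms average to 0.\<close>

lemma contraction_right_of_axis:
  assumes re: "\<And>s. 0 < Re s \<Longrightarrow> \<delta> \<le> Re (\<phi> s)"
    and b: "entire_dirichlet S b (\<lambda>s. \<Sum>n=1..M. a n * of_nat n powr (- \<phi> s))"
    and G: "finite G" "G \<subseteq> S" and \<sigma>: "0 < \<sigma>"
  shows "(\<Sum>k\<in>G. (cmod (b k))\<^sup>2 * real k powr (- 2 * \<sigma>)) \<le> (\<Sum>n=1..M. (cmod (a n))\<^sup>2 * real n powr (- 2 * \<delta>))"
proof (cases "M = 0")
  case True
  \<comment> \<open>The chain bound starts at frequency 1 and requires 1 \<le> M, so the empty sum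
    is treated with the zero majorant.\<close>
  then have "entire_dirichlet S b (\<lambda>s. 0)" using b by simp
  from generic_step obtain \<tau> :: real
    where \<tau>: "\<And>q. q \<in> \<rat> \<Longrightarrow> 0 < q \<Longrightarrow> cis (\<tau> * ln q) = 1 \<Longrightarrow> q = 1" by blast
  show ?thesis
    by (rule average_square_ge[OF \<open>entire_dirichlet S b (\<lambda>s. 0)\<close> \<tau> _ _ G, where h = "\<lambda>_. 0"]) (auto simp: True)
next
  case False
  then have M: "1 \<le> M" by simp
  from generic_step obtain \<tau> :: real
    where \<tau>: "\<And>q. q \<in> \<rat> \<Longrightarrow> 0 < q \<Longrightarrow> cis (\<tau> * ln q) = 1 \<Longrightarrow> q = 1" by blast
  define s where "s = (\<lambda>j. Complex \<sigma> (\<tau> * real j))"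
  define a' where "a' = (\<lambda>n. a n * of_real (real n powr (- \<delta>)))"
  define E where "E = (\<lambda>j n m. exp (- of_real (ln (real n) - ln (real m)) * (\<phi> (s j) - of_real \<delta>)))"
  define h where "h = (\<lambda>j. (\<Sum>n=1..M. (cmod (a' n))\<^sup>2) +
      2 * (\<Sum>m=1..M. \<Sum>n\<in>{m<..M}. Re (cnj (a' m) * a' n * E j n m)))"
  show ?thesis
  proof (rule average_square_ge[OF b \<tau> _ _ G, where h = h])
    fix j
    have "0 \<le> Re (\<phi> (s j) - of_real \<delta>)" using re[of "s j"] \<sigma> by (simp add: s_def)
    from contraction_chain_bound[OF this _ M, of a']
    have "(cmod (\<Sum>n=1..M. a' n * E j n 1))\<^sup>2 \<le> h j" unfolding h_def E_def by simp
    also have "(\<Sum>n=1..M. a' n * E j n 1) = (\<Sum>n=1..M. a n * of_nat n powr (- \<phi> (s j)))"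
    proof (rule sum.cong[OF refl])
      fix n assume "n \<in> {1..M}"
      then show "a' n * E j n 1 = a n * of_nat n powr (- \<phi> (s j))"
        by (simp add: a'_def E_def of_nat_powr_complex powr_def flip: exp_of_real exp_add)
          (simp add: algebra_simps)
    qed
    finally show "(cmod (\<Sum>n=1..M. a n * of_nat n powr (- \<phi> (Complex \<sigma> (\<tau> * real j)))))\<^sup>2 \<le> h j"
      by (simp add: s_def)
  next
    have E0: "(\<lambda>K. (\<Sum>j<K. E j n m) / of_nat K) \<longlonglongrightarrow> 0" if "1 \<le> m" "m < n" for n m
    proof -
      define r where "r = ln (real n) - ln (real m)"
      \<comment> \<open>The cross term is \<open>q powr s\<close> times an entire series with
        frequencies k in S, so its mean would come from k = q. Since c0 \<ge> 1 gives 0 < q < 1, no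
        such k exists.\<close>
      define q where "q = (real m / real n) ^ c0"
      obtain d where d: "entire_dirichlet S d (\<lambda>s. exp (- of_real r * (\<phi> s - of_nat c0 * s - of_real \<delta>)))"
        using entire_dirichlet_exp_symbol by blast
      have q: "q \<in> \<rat>" "0 < q" "q < 1" using that char by (auto simp: q_def power_less_one_iff)
      have ln_q: "ln q = - real c0 * r" using that by (simp add: q_def r_def ln_realpow ln_div algebra_simps)
      have E_r: "E j n m = exp (- of_real r * (\<phi> (s j) - of_real \<delta>))" for j
        by (simp add: E_def r_def)
      have kq: "real k = q \<Longrightarrow> k = 0" for k using q by (cases k) auto
      have "d 0 = 0" using d pos[of 0] by (auto simp: entire_dirichlet_def)
      then have "(\<lambda>k. if real k = q then d k * of_nat k powr (- of_real \<sigma>) else 0) = (\<lambda>k. 0)"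
        using kq by (auto simp: fun_eq_iff)
      moreover have "(\<lambda>K. (\<Sum>j<K. cis (real j * (\<tau> * ln q)) *
          exp (- of_real r * (\<phi> (s j) - of_nat c0 * s j - of_real \<delta>))) / of_nat K)
          \<longlonglongrightarrow> (\<Sum>k. if real k = q then d k * of_nat k powr (- of_real \<sigma>) else 0)"
        unfolding s_def by (rule average_entire_dirichlet[OF d _ q(1,2)]) (rule \<tau>)
      ultimately have "(\<lambda>K. (\<Sum>j<K. cis (real j * (\<tau> * ln q)) *
          exp (- of_real r * (\<phi> (s j) - of_nat c0 * s j - of_real \<delta>))) / of_nat K) \<longlonglongrightarrow> 0"
        by simp
      from tendsto_mult_left[OF this, of "of_real (exp (- real c0 * r * \<sigma>))"]
      have "(\<lambda>K. of_real (exp (- real c0 * r * \<sigma>)) * ((\<Sum>j<K. cis (real j * (\<tau> * ln q)) *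
          exp (- of_real r * (\<phi> (s j) - of_nat c0 * s j - of_real \<delta>))) / of_nat K)) \<longlonglongrightarrow> 0"
        by simp
      moreover have "of_real (exp (- real c0 * r * \<sigma>)) * (cis (real j * (\<tau> * ln q)) *
          exp (- of_real r * (\<phi> (s j) - of_nat c0 * s j - of_real \<delta>))) = E j n m" for j
        unfolding ln_q E_r
        by (simp add: cis_conv_exp s_def flip: exp_of_real exp_add)
          (simp add: Complex_eq algebra_simps)
      ultimately show ?thesis by (simp add: sum_distrib_left)
    qed
    have "(\<lambda>K. \<Sum>m=1..M. \<Sum>n\<in>{m<..M}. Re (cnj (a' m) * a' n * ((\<Sum>j<K. E j n m) / of_nat K)))
        \<longlonglongrightarrow> (\<Sum>m=1..M. \<Sum>n\<in>{m<..M}. Re (cnj (a' m) * a' n * 0))"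
      by (intro tendsto_sum tendsto_Re tendsto_mult_left E0) auto
    then have cross: "(\<lambda>K. \<Sum>m=1..M. \<Sum>n\<in>{m<..M}. Re (cnj (a' m) * a' n * ((\<Sum>j<K. E j n m) / of_nat K)))
        \<longlonglongrightarrow> 0" by simp
    have "\<forall>\<^sub>F K in sequentially. (\<Sum>n=1..M. (cmod (a' n))\<^sup>2) +
        2 * (\<Sum>m=1..M. \<Sum>n\<in>{m<..M}. Re (cnj (a' m) * a' n * ((\<Sum>j<K. E j n m) / of_nat K))) =
        (\<Sum>j<K. h j) / real K"
    proof (rule eventually_mono[OF eventually_gt_at_top[of 0]])
      fix K :: nat assume K: "0 < K"
      have "Re (x / of_nat K) = Re x / real K" for x
        using Re_divide_of_real[of x "real K"] by simp
      then have "Re (cnj (a' m) * a' n * ((\<Sum>j<K. E j n m) / of_nat K)) =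
          (\<Sum>j<K. Re (cnj (a' m) * a' n * E j n m)) / real K" for m n
        by (simp only: times_divide_eq_right sum_distrib_left Re_sum)
      then have "(\<Sum>m=1..M. \<Sum>n\<in>{m<..M}. Re (cnj (a' m) * a' n * ((\<Sum>j<K. E j n m) / of_nat K))) =
          (\<Sum>m=1..M. \<Sum>n\<in>{m<..M}. \<Sum>j<K. Re (cnj (a' m) * a' n * E j n m)) / real K"
        by (simp only: sum_divide_distrib)
      also have "(\<Sum>m=1..M. \<Sum>n\<in>{m<..M}. \<Sum>j<K. Re (cnj (a' m) * a' n * E j n m)) =
          (\<Sum>j<K. \<Sum>m=1..M. \<Sum>n\<in>{m<..M}. Re (cnj (a' m) * a' n * E j n m))"
        by (simp only: sum.swap[of _ "{..<K}"])
      finally show "(\<Sum>n=1..M. (cmod (a' n))\<^sup>2) +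
        2 * (\<Sum>m=1..M. \<Sum>n\<in>{m<..M}. Re (cnj (a' m) * a' n * ((\<Sum>j<K. E j n m) / of_nat K))) =
        (\<Sum>j<K. h j) / real K"
        using K by (simp only: h_def sum.distrib sum_distrib_left[symmetric])
          (simp add: field_simps)
    qed
    moreover have "(\<lambda>K. (\<Sum>n=1..M. (cmod (a' n))\<^sup>2) +
        2 * (\<Sum>m=1..M. \<Sum>n\<in>{m<..M}. Re (cnj (a' m) * a' n * ((\<Sum>j<K. E j n m) / of_nat K))))
        \<longlonglongrightarrow> (\<Sum>n=1..M. (cmod (a' n))\<^sup>2) + 2 * 0"
      by (intro tendsto_intros cross)
    ultimately have "(\<lambda>K. (\<Sum>j<K. h j) / real K) \<longlonglongrightarrow> (\<Sum>n=1..M. (cmod (a' n))\<^sup>2) + 2 * 0"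
      using tendsto_cong by fast
    also have "(\<Sum>n=1..M. (cmod (a' n))\<^sup>2) + 2 * 0 = (\<Sum>n=1..M. (cmod (a n))\<^sup>2 * real n powr (- 2 * \<delta>))"
    proof -
      have "real n powr (- 2 * \<delta>) = (real n powr - \<delta>)\<^sup>2" for n
        by (simp add: power2_eq_square flip: powr_add)
      then show ?thesis by (simp add: a'_def norm_mult power_mult_distrib)
    qed
    finally show "(\<lambda>K. (\<Sum>j<K. h j) / real K) \<longlonglongrightarrow> (\<Sum>n=1..M. (cmod (a n))\<^sup>2 * real n powr (- 2 * \<delta>))" .
  qed
qed

text \<open>The bound on Re \<phi> lives on the open half-plane, so the estimate is first made at
  \<sigma> > 0. Because G is finite, \<sigma> can tend to 0 from the right term by term.\<close>

lemma contraction_poly: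
  assumes re: "\<And>s. 0 < Re s \<Longrightarrow> \<delta> \<le> Re (\<phi> s)"
    and b: "entire_dirichlet S b (\<lambda>s. \<Sum>n=1..M. a n * of_nat n powr (- \<phi> s))"
    and G: "finite G"
  shows "(\<Sum>k\<in>G. (cmod (b k))\<^sup>2) \<le> (\<Sum>n=1..M. (cmod (a n))\<^sup>2 * real n powr (- 2 * \<delta>))"
proof -
  have "((\<lambda>\<sigma>. \<Sum>k\<in>G \<inter> S. (cmod (b k))\<^sup>2 * real k powr (- 2 * \<sigma>)) \<longlongrightarrow>
      (\<Sum>k\<in>G \<inter> S. (cmod (b k))\<^sup>2 * real k powr (- 2 * 0))) (at_right 0)"
    using pos by (intro tendsto_sum tendsto_mult tendsto_powr tendsto_const tendsto_ident_at) force+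
  moreover have "\<forall>\<^sub>F \<sigma> in at_right 0. (\<Sum>k\<in>G \<inter> S. (cmod (b k))\<^sup>2 * real k powr (- 2 * \<sigma>)) \<le>
      (\<Sum>n=1..M. (cmod (a n))\<^sup>2 * real n powr (- 2 * \<delta>))"
    by (rule eventually_mono[OF eventually_at_right_less])
      (use contraction_right_of_axis[OF re b, of "G \<inter> S"] G in auto)
  ultimately have "(\<Sum>k\<in>G \<inter> S. (cmod (b k))\<^sup>2 * real k powr (- 2 * 0)) \<le>
      (\<Sum>n=1..M. (cmod (a n))\<^sup>2 * real n powr (- 2 * \<delta>))"
    by (rule tendsto_upperbound) simp
  also have "(\<Sum>k\<in>G \<inter> S. (cmod (b k))\<^sup>2 * real k powr (- 2 * 0)) = (\<Sum>k\<in>G. (cmod (b k))\<^sup>2)"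
    using G b pos by (intro sum.mono_neutral_cong_left) (auto simp: entire_dirichlet_def dest!: pos)
  finally show ?thesis .
qed

end

subsection \<open>Restricted range implies compactness\<close>

lemma l2_Cauchy_Schwarz:
  fixes a e :: "nat \<Rightarrow> complex"
  assumes a: "summable (\<lambda>n. (cmod (a n))\<^sup>2)" and e: "summable (\<lambda>n. (cmod (e n))\<^sup>2)"
  shows "summable (\<lambda>n. a n * e n)"
    and "cmod (\<Sum>n. a n * e n) \<le> sqrt (\<Sum>n. (cmod (a n))\<^sup>2) * sqrt (\<Sum>n. (cmod (e n))\<^sup>2)"
proof -
  have fin: "(\<Sum>n<K. cmod (a n * e n)) \<le> sqrt (\<Sum>n. (cmod (a n))\<^sup>2) * sqrt (\<Sum>n. (cmod (e n))\<^sup>2)" for K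
  proof -
    have "(\<Sum>n<K. cmod (a n * e n)) \<le> L2_set (\<lambda>n. cmod (a n)) {..<K} * L2_set (\<lambda>n. cmod (e n)) {..<K}"
      using L2_set_mult_ineq[of "\<lambda>n. cmod (a n)" "\<lambda>n. cmod (e n)" "{..<K}"] by (simp add: norm_mult)
    also have "\<dots> \<le> sqrt (\<Sum>n. (cmod (a n))\<^sup>2) * sqrt (\<Sum>n. (cmod (e n))\<^sup>2)"
      unfolding L2_set_def
      by (intro mult_mono real_sqrt_le_mono sum_le_suminf a e real_sqrt_ge_zero suminf_nonneg sum_nonneg) auto
    finally show ?thesis .
  qed
  have sn: "summable (\<lambda>n. cmod (a n * e n))"
    by (rule summableI_nonneg_bounded[OF _ fin]) simp
  then show "summable (\<lambda>n. a n * e n)" by (rule summable_norm_cancel)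
  show "cmod (\<Sum>n. a n * e n) \<le> sqrt (\<Sum>n. (cmod (a n))\<^sup>2) * sqrt (\<Sum>n. (cmod (e n))\<^sup>2)"
    by (rule order_trans[OF summable_norm[OF sn] suminf_le_const[OF sn fin]])
qed

lemma square_summable_coeff_le:
  assumes "a \<in> square_summable" "(\<Sum>n. (cmod (a n))\<^sup>2) \<le> C"
  shows "(cmod (a n))\<^sup>2 \<le> C"
  using sum_le_suminf[of "\<lambda>n. (cmod (a n))\<^sup>2" "{n}"] assms by (auto simp: square_summable_def)

lemma square_summableI:
  assumes "a 0 = 0" "\<And>K. (\<Sum>n<K. (cmod (a n))\<^sup>2) \<le> C"
  shows "a \<in> square_summable" "(\<Sum>n. (cmod (a n))\<^sup>2) \<le> C"
proof -
  have s: "summable (\<lambda>n. (cmod (a n))\<^sup>2)"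
    by (rule summableI_nonneg_bounded[OF _ assms(2)]) simp
  then show "a \<in> square_summable" using assms(1) by (simp add: square_summable_def)
  show "(\<Sum>n. (cmod (a n))\<^sup>2) \<le> C" by (rule suminf_le_const[OF s assms(2)])
qed

text \<open>Sequential weak compactness of balls: a diagonal argument gives convergence of every
  coefficient, and the bound on finite partial sums passes to the limit.\<close>

lemma square_summable_weak_subsequence:
  assumes a: "\<And>j. a j \<in> square_summable" and C: "\<And>j. (\<Sum>n. (cmod (a j n))\<^sup>2) \<le> C"
  obtains r \<alpha> where "strict_mono (r :: nat \<Rightarrow> nat)" "\<alpha> \<in> square_summable"
    "(\<Sum>n. (cmod (\<alpha> n))\<^sup>2) \<le> C" "\<And>n. (\<lambda>j. a (r j) n) \<longlonglongrightarrow> \<alpha> n"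
proof -
  have "cmod (a j n) \<le> sqrt C" for j n
    using square_summable_coeff_le[OF a C] by (simp add: real_le_rsqrt)
  then have "\<exists>r. strict_mono (r :: nat \<Rightarrow> nat) \<and> (\<forall>n. \<exists>l. (\<lambda>j. a (r j) n) \<longlonglongrightarrow> l)"
    by (rule function_convergent_subsequence[of UNIV a "sqrt C", OF countableI_type]) auto
  then obtain r :: "nat \<Rightarrow> nat" where r: "strict_mono r" "\<And>n. \<exists>l. (\<lambda>j. a (r j) n) \<longlonglongrightarrow> l"
    by blast
  then obtain \<alpha> where \<alpha>: "\<And>n. (\<lambda>j. a (r j) n) \<longlonglongrightarrow> \<alpha> n" by metis
  have "\<alpha> 0 = 0"
    using \<alpha>[of 0] a by (simp add: square_summable_def LIMSEQ_const_iff)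
  moreover have "(\<Sum>n<K. (cmod (\<alpha> n))\<^sup>2) \<le> C" for K
  proof (rule LIMSEQ_le_const2)
    show "(\<lambda>j. \<Sum>n<K. (cmod (a (r j) n))\<^sup>2) \<longlonglongrightarrow> (\<Sum>n<K. (cmod (\<alpha> n))\<^sup>2)"
      by (intro tendsto_intros \<alpha>)
    have "(\<Sum>n<K. (cmod (a j n))\<^sup>2) \<le> C" for j
      using a[of j] by (intro order_trans[OF sum_le_suminf C]) (auto simp: square_summable_def)
    then show "\<exists>J. \<forall>j\<ge>J. (\<Sum>n<K. (cmod (a (r j) n))\<^sup>2) \<le> C" by blast
  qed
  ultimately have "\<alpha> \<in> square_summable" "(\<Sum>n. (cmod (\<alpha> n))\<^sup>2) \<le> C"
    by (rule square_summableI)+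
  from that[OF r(1) this \<alpha>] show ?thesis .
qed

text \<open>This is the compactness of the diagonal operator: the tail is small because v is small
  there and the norms are bounded, while the finite head tends to 0 coefficientwise.\<close>

lemma weighted_l2_tendsto_0:
  assumes d: "\<And>j. d j \<in> square_summable" and C: "\<And>j. (\<Sum>n. (cmod (d j n))\<^sup>2) \<le> C"
    and lim: "\<And>n. (\<lambda>j. d j n) \<longlonglongrightarrow> 0"
    and v: "v \<longlonglongrightarrow> 0" "\<And>n. 0 \<le> v n"
  shows "\<And>j. summable (\<lambda>n. (cmod (d j n))\<^sup>2 * v n)"
    and "(\<lambda>j. \<Sum>n. (cmod (d j n))\<^sup>2 * v n) \<longlonglongrightarrow> 0"
proof -
  have sd: "summable (\<lambda>n. (cmod (d j n))\<^sup>2)" for j using d by (simp add: square_summable_def)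
  have C0: "0 \<le> C" using square_summable_coeff_le[OF d C] by (meson order_trans zero_le_power2)
  have "Bseq v" using v(1) by (intro convergent_imp_Bseq convergentI)
  then obtain V where "\<And>n. norm (v n) \<le> V" by (metis BseqE)
  then have V: "v n \<le> V" for n using v(2)[of n] by (metis abs_of_nonneg real_norm_def)
  show sv: "summable (\<lambda>n. (cmod (d j n))\<^sup>2 * v n)" for j
    by (rule summable_comparison_test'[OF summable_mult2[OF sd, of _ V]])
      (auto simp: v(2) intro: mult_left_mono V)
  show "(\<lambda>j. \<Sum>n. (cmod (d j n))\<^sup>2 * v n) \<longlonglongrightarrow> 0"
  proof (rule LIMSEQ_I)
    fix \<epsilon> :: real assume \<epsilon>: "0 < \<epsilon>"
    \<comment> \<open>The summand 1 keeps the denominator positive when C = 0 and makes C * \<eta> <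
      \<epsilon> / 2 strict.\<close>
    define \<eta> where "\<eta> = \<epsilon> / (2 * (C + 1))"
    have \<eta>: "0 < \<eta>" "C * \<eta> < \<epsilon> / 2" using \<epsilon> C0 by (auto simp: \<eta>_def field_simps)
    obtain K where "\<And>n. n \<ge> K \<Longrightarrow> v n < \<eta>"
      using order_tendstoD(2)[OF v(1) \<eta>(1)] by (auto simp: eventually_sequentially)
    then have K: "n \<ge> K \<Longrightarrow> v n \<le> \<eta>" for n by (simp add: less_imp_le)
    have "(\<lambda>j. \<Sum>n<K. (cmod (d j n))\<^sup>2 * v n) \<longlonglongrightarrow> (\<Sum>n<K. (cmod 0)\<^sup>2 * v n)"
      by (intro tendsto_intros lim)
    then have "(\<lambda>j. \<Sum>n<K. (cmod (d j n))\<^sup>2 * v n) \<longlonglongrightarrow> 0" by simp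
    then obtain J where J: "\<And>j. j \<ge> J \<Longrightarrow> (\<Sum>n<K. (cmod (d j n))\<^sup>2 * v n) < \<epsilon> / 2"
      using order_tendstoD(2)[of _ 0 sequentially "\<epsilon> / 2"] \<epsilon> by (auto simp: eventually_sequentially)
    have "norm ((\<Sum>n. (cmod (d j n))\<^sup>2 * v n) - 0) < \<epsilon>" if j: "j \<ge> J" for j
    proof -
      have s2: "summable (\<lambda>n. (cmod (d j (n + K)))\<^sup>2 * v (n + K))" "summable (\<lambda>n. (cmod (d j (n + K)))\<^sup>2)"
        using summable_ignore_initial_segment[OF sv] summable_ignore_initial_segment[OF sd] by auto
      have "(\<Sum>n. (cmod (d j (n + K)))\<^sup>2 * v (n + K)) \<le> (\<Sum>n. (cmod (d j (n + K)))\<^sup>2 * \<eta>)"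
        by (intro suminf_le s2 summable_mult2 mult_left_mono K) auto
      also have "\<dots> = (\<Sum>n. (cmod (d j (n + K)))\<^sup>2) * \<eta>"
        by (rule suminf_mult2[OF s2(2), symmetric])
      also have "\<dots> \<le> C * \<eta>"
      proof (rule mult_right_mono)
        have "(\<Sum>n. (cmod (d j (n + K)))\<^sup>2) \<le> (\<Sum>n. (cmod (d j n))\<^sup>2)"
          unfolding suminf_split_initial_segment[OF sd[of j], of K] by (simp add: sum_nonneg)
        then show "(\<Sum>n. (cmod (d j (n + K)))\<^sup>2) \<le> C" using C order_trans by blast
      qed (use \<eta> in simp)
      finally have "(\<Sum>n. (cmod (d j n))\<^sup>2 * v n) < \<epsilon>"
        unfolding suminf_split_initial_segment[OF sv[of j], of K] using J[OF j] \<eta>(2) by linarith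
      moreover have "0 \<le> (\<Sum>n. (cmod (d j n))\<^sup>2 * v n)"
        by (intro suminf_nonneg sv) (simp add: v(2))
      ultimately show ?thesis by simp
    qed
    then show "\<exists>J. \<forall>j\<ge>J. norm ((\<Sum>n. (cmod (d j n))\<^sup>2 * v n) - 0) < \<epsilon>" by blast
  qed
qed

lemma powr_neg_tendsto_0:
  assumes "0 < (\<eta> :: real)"
  shows "(\<lambda>n. real n powr (- 2 * \<eta>)) \<longlonglongrightarrow> 0"
  using assms by (intro tendsto_neg_powr filterlim_real_sequentially) simp

lemma l2_diff_bounds:
  assumes a: "a \<in> square_summable" "(\<Sum>n. (cmod (a n))\<^sup>2) \<le> C"
    and b: "b \<in> square_summable" "(\<Sum>n. (cmod (b n))\<^sup>2) \<le> C"
  shows "(\<Sum>n. (cmod (a n - b n))\<^sup>2) \<le> 4 * C"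
proof -
  have "sqrt (\<Sum>n. (cmod (a n - b n))\<^sup>2) \<le> sqrt C + sqrt C"
    by (rule order_trans[OF l2_triangle[OF a(1) b(1)]]) (intro add_mono real_sqrt_le_mono a b)
  also have "\<dots> = sqrt (4 * C)" by (simp add: real_sqrt_mult)
  finally show ?thesis by simp
qed

text \<open>Point evaluation is weakly continuous. Half of the distance from s to the line Re s =
  1/2 is spent on weights n^(-\<eta>), which make the coefficient differences tend to 0 in norm; the
  factor e that remains is still square summable, so Cauchy-Schwarz applies.\<close>

lemma dirichlet_series_weak_tendsto:
  assumes b: "\<And>j. b j \<in> square_summable" "\<And>j. (\<Sum>n. (cmod (b j n))\<^sup>2) \<le> C"
    and \<beta>: "\<beta> \<in> square_summable" "(\<Sum>n. (cmod (\<beta> n))\<^sup>2) \<le> C"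
    and lim: "\<And>n. (\<lambda>j. b j n) \<longlonglongrightarrow> \<beta> n"
    and s: "s \<in> right_halfplane (1/2)"
  shows "(\<lambda>j. dirichlet_series (b j) s) \<longlonglongrightarrow> dirichlet_series \<beta> s"
proof -
  define \<eta> where "\<eta> = (Re s - 1/2) / 2"
  have \<eta>: "0 < \<eta>" "Re s - \<eta> > 1/2" using s by (auto simp: \<eta>_def right_halfplane_def field_simps)
  define d where "d = (\<lambda>j n. b j n - \<beta> n)"
  have d: "d j \<in> square_summable" for j unfolding d_def by (rule square_summable_diff[OF b(1) \<beta>(1)])
  have dC: "(\<Sum>n. (cmod (d j n))\<^sup>2) \<le> 4 * C" for j
    unfolding d_def by (rule l2_diff_bounds[OF b \<beta>])
  have d0: "(\<lambda>j. d j n) \<longlonglongrightarrow> 0" for n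
    using tendsto_diff[OF lim[of n] tendsto_const[of "\<beta> n"]] by (simp add: d_def)
  note W = weighted_l2_tendsto_0[OF d dC d0 powr_neg_tendsto_0[OF \<eta>(1)] powr_ge_zero]
  define e where "e = (\<lambda>n. complex_of_real (real n powr \<eta>) * of_nat n powr (- s))"
  have ne: "cmod (e n) = real n powr (- (Re s - \<eta>))" for n
  proof (cases "n = 0")
    case False
    then have "cmod (of_nat n powr (- s)) = real n powr (- Re s)"
      by (subst norm_powr_real_powr) auto
    then show ?thesis by (simp add: e_def norm_mult flip: powr_add)
  qed (simp add: e_def)
  have powr2: "(real n powr x)\<^sup>2 = real n powr (2 * x)" for n x
    by (simp add: power2_eq_square flip: powr_add)
  have se: "summable (\<lambda>n. (cmod (e n))\<^sup>2)"
  proof -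
    have "(\<lambda>n. (cmod (e n))\<^sup>2) = (\<lambda>n. real n powr (- 2 * (Re s - \<eta>)))"
      by (simp add: ne powr2 fun_eq_iff)
    then show ?thesis using \<eta>(2) by (simp add: summable_real_powr_iff)
  qed
  have sq: "(cmod (d j n * of_real (real n powr - \<eta>)))\<^sup>2 = (cmod (d j n))\<^sup>2 * real n powr (- 2 * \<eta>)" for j n
    by (simp add: norm_mult power_mult_distrib powr2)
  have eq: "d j n * of_real (real n powr - \<eta>) * e n = d j n * of_nat n powr (- s)" for j n
  proof (cases "n = 0")
    case False
    then have "real n powr - \<eta> * real n powr \<eta> = 1" by (simp add: powr_minus)
    then have "complex_of_real (real n powr - \<eta>) * of_real (real n powr \<eta>) = 1"
      by (metis of_real_1 of_real_mult)
    then show ?thesis by (simp add: e_def)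
  qed simp
  have bd: "cmod (dirichlet_series (d j) s) \<le>
      sqrt (\<Sum>n. (cmod (d j n))\<^sup>2 * real n powr (- 2 * \<eta>)) * sqrt (\<Sum>n. (cmod (e n))\<^sup>2)" for j
  proof -
    have "summable (\<lambda>n. (cmod (d j n * of_real (real n powr - \<eta>)))\<^sup>2)"
      unfolding sq by (rule W(1))
    from l2_Cauchy_Schwarz(2)[OF this se] show ?thesis
      unfolding sq eq dirichlet_series_def .
  qed
  have "(\<lambda>j. sqrt (\<Sum>n. (cmod (d j n))\<^sup>2 * real n powr (- 2 * \<eta>)) * sqrt (\<Sum>n. (cmod (e n))\<^sup>2))
      \<longlonglongrightarrow> sqrt 0 * sqrt (\<Sum>n. (cmod (e n))\<^sup>2)"
    by (rule tendsto_mult_right[OF tendsto_real_sqrt[OF W(2)]])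
  then have "(\<lambda>j. sqrt (\<Sum>n. (cmod (d j n))\<^sup>2 * real n powr (- 2 * \<eta>)) * sqrt (\<Sum>n. (cmod (e n))\<^sup>2))
      \<longlonglongrightarrow> 0" by simp
  then have "(\<lambda>j. dirichlet_series (d j) s) \<longlonglongrightarrow> 0"
    by (rule Lim_null_comparison[OF always_eventually, rotated]) (use bd in simp)
  moreover have "dirichlet_series (d j) s = dirichlet_series (b j) s - dirichlet_series \<beta> s" for j
    using fun_cong[OF h2_fun_diff[OF b(1)[of j] \<beta>(1)], of s] s by (simp add: h2_fun_def d_def)
  ultimately have "(\<lambda>j. dirichlet_series (b j) s - dirichlet_series \<beta> s) \<longlonglongrightarrow> 0" by simp
  then show ?thesis by (rule LIM_zero_cancel)
qed

lemma (in mult_semigroup) entire_dirichlet_square_summable: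
  assumes "entire_dirichlet S b F" "\<And>G. finite G \<Longrightarrow> (\<Sum>k\<in>G. (cmod (b k))\<^sup>2) \<le> C"
  shows "b \<in> square_summable" "(\<Sum>k. (cmod (b k))\<^sup>2) \<le> C" "dirichlet_series b s = F s"
proof -
  have "b 0 = 0" using assms(1) pos[of 0] by (auto simp: entire_dirichlet_def)
  then show "b \<in> square_summable" "(\<Sum>k. (cmod (b k))\<^sup>2) \<le> C"
    using square_summableI[of b C] assms(2) by auto
  have "(\<lambda>k. b k * of_nat k powr (- s)) sums F s"
    using assms(1) by (auto simp: entire_dirichlet_def intro: has_sum_imp_sums)
  then show "dirichlet_series b s = F s" by (simp add: dirichlet_series_def sums_iff)
qed

context polynomial_symbol
begin

lemma entire_dirichlet_poly_symbol:
  assumes "\<And>n. n \<in> {1..M} \<Longrightarrow> n \<in> S \<or> a n = 0"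
  obtains b where "entire_dirichlet S b (\<lambda>s. \<Sum>n=1..M. a n * of_nat n powr (- \<phi> s))"
proof -
  have "\<exists>B. entire_dirichlet S B (\<lambda>s. a n * of_nat n powr (- \<phi> s))" if n: "n \<in> {1..M}" for n
  proof (cases "n \<in> S")
    case True
    then show ?thesis
      using entire_dirichlet_powr_symbol entire_dirichlet_cmult by metis
  next
    case False
    then have "a n = 0" using assms[OF n] by auto
    then show ?thesis using entire_dirichlet_zero[of S] by auto
  qed
  then obtain B where "\<And>n. n \<in> {1..M} \<Longrightarrow> entire_dirichlet S (B n) (\<lambda>s. a n * of_nat n powr (- \<phi> s))"
    by metis
  from entire_dirichlet_sum[of "{1..M}", OF this] show ?thesis by (rule that)
qed

end

section \<open>Compactness when the symbol keeps a positive distance from the imaginary axis\<close>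

lemma h2_norm_square: "a \<in> square_summable \<Longrightarrow> (h2_norm (h2_fun a))\<^sup>2 = (\<Sum>n. (cmod (a n))\<^sup>2)"
  by (subst h2_norm_h2_fun) (auto simp: square_summable_def suminf_nonneg)

text \<open>Taking S to be all positive integers admits every square-summable coefficient
  sequence.\<close>

locale compact_symbol = polynomial_symbol "{0<..}" c0 N c \<phi>
  for c0 N c \<phi> +
  fixes \<delta> :: real
  assumes self_map: "\<phi> ` right_halfplane (1/2) \<subseteq> right_halfplane (1/2)"
    and Re_ge: "0 < Re s \<Longrightarrow> \<delta> \<le> Re (\<phi> s)"
    and \<delta>_pos: "0 < \<delta>"
begin

lemma weighted_summable:
  assumes "a \<in> square_summable"
  shows "summable (\<lambda>n. (cmod (a n))\<^sup>2 * real n powr (- 2 * \<delta>))"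
proof (rule summable_comparison_test')
  show "summable (\<lambda>n. (cmod (a n))\<^sup>2)" using assms by (simp add: square_summable_def)
  fix n :: nat assume n: "n \<ge> 1"
  have "real n powr (- 2 * \<delta>) \<le> real n powr 0" using n \<delta>_pos by (intro powr_mono) auto
  then show "norm ((cmod (a n))\<^sup>2 * real n powr (- 2 * \<delta>)) \<le> (cmod (a n))\<^sup>2"
    using n by (auto intro: mult_left_le)
qed

text \<open>Truncations of a compose to entire Dirichlet series with uniformly bounded coefficient
  norms. A weak limit \<beta> inherits the bound, and evaluation at points with Re s > 1/2
  identifies its series with the composition, since \<phi> s stays in that half-plane.\<close>

lemma composition_h2_fun:
  assumes a: "a \<in> square_summable"
  obtains b where "b \<in> square_summable" "composition_operator \<phi> (h2_fun a) = h2_fun b"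
    "(\<Sum>n. (cmod (b n))\<^sup>2) \<le> (\<Sum>n. (cmod (a n))\<^sup>2 * real n powr (- 2 * \<delta>))"
proof -
  define C where "C = (\<Sum>n. (cmod (a n))\<^sup>2 * real n powr (- 2 * \<delta>))"
  have "\<exists>b. entire_dirichlet {0<..} b (\<lambda>s. \<Sum>n=1..M. a n * of_nat n powr (- \<phi> s))" for M
  proof (rule entire_dirichlet_poly_symbol[of M a])
    show "n \<in> {0<..} \<or> a n = 0" if "n \<in> {1..M}" for n using that by simp
  qed (rule exI)
  then have "\<exists>b. \<forall>M. entire_dirichlet {0<..} (b M) (\<lambda>s. \<Sum>n=1..M. a n * of_nat n powr (- \<phi> s))"
    by (intro choice allI)
  then obtain b where b: "entire_dirichlet {0<..} (b M) (\<lambda>s. \<Sum>n=1..M. a n * of_nat n powr (- \<phi> s))" for M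
    by blast
  have bC: "(\<Sum>k\<in>G. (cmod (b M k))\<^sup>2) \<le> C" if "finite G" for M G
  proof -
    have "(\<Sum>k\<in>G. (cmod (b M k))\<^sup>2) \<le> (\<Sum>n=1..M. (cmod (a n))\<^sup>2 * real n powr (- 2 * \<delta>))"
      by (rule contraction_poly[OF Re_ge b that])
    also have "\<dots> \<le> C" unfolding C_def by (intro sum_le_suminf weighted_summable a) auto
    finally show ?thesis .
  qed
  have ss: "b M \<in> square_summable" "(\<Sum>k. (cmod (b M k))\<^sup>2) \<le> C" for M
    by (rule entire_dirichlet_square_summable[OF b bC], assumption)+
  obtain r \<beta> where r: "strict_mono r" and \<beta>: "\<beta> \<in> square_summable" "(\<Sum>n. (cmod (\<beta> n))\<^sup>2) \<le> C"
    and lim: "\<And>n. (\<lambda>j. b (r j) n) \<longlonglongrightarrow> \<beta> n"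
    by (rule square_summable_weak_subsequence[of b C, OF ss], rule that)
  have "composition_operator \<phi> (h2_fun a) s = h2_fun \<beta> s" for s
  proof (cases "s \<in> right_halfplane (1/2)")
    case True
    then have \<phi>s: "\<phi> s \<in> right_halfplane (1/2)" using self_map by auto
    have "(\<lambda>M. \<Sum>n\<le>M. a n * of_nat n powr (- \<phi> s)) \<longlonglongrightarrow> dirichlet_series a (\<phi> s)"
      unfolding dirichlet_series_def by (rule summable_LIMSEQ'[OF dirichlet_series_summable[OF a \<phi>s]])
    moreover have "(\<Sum>n\<le>M. a n * of_nat n powr (- \<phi> s)) = dirichlet_series (b M) s" for M
    proof -
      have "(\<Sum>n\<le>M. a n * of_nat n powr (- \<phi> s)) = (\<Sum>n=1..M. a n * of_nat n powr (- \<phi> s))"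
        by (rule sum.mono_neutral_right) (auto simp: not_less_eq_eq)
      also have "\<dots> = dirichlet_series (b M) s"
        by (rule entire_dirichlet_square_summable(3)[OF b bC, symmetric])
      finally show ?thesis .
    qed
    ultimately have "(\<lambda>M. dirichlet_series (b M) s) \<longlonglongrightarrow> dirichlet_series a (\<phi> s)" by simp
    from LIMSEQ_subseq_LIMSEQ[OF this r]
    have "(\<lambda>j. dirichlet_series (b (r j)) s) \<longlonglongrightarrow> dirichlet_series a (\<phi> s)" by (simp add: o_def)
    moreover have "(\<lambda>j. dirichlet_series (b (r j)) s) \<longlonglongrightarrow> dirichlet_series \<beta> s"
      by (rule dirichlet_series_weak_tendsto[OF ss(1,2) \<beta> lim True])
    ultimately have "dirichlet_series a (\<phi> s) = dirichlet_series \<beta> s" by (rule LIMSEQ_unique)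
    then show ?thesis using True \<phi>s by (simp add: composition_operator_def h2_fun_def)
  qed (simp add: composition_operator_def h2_fun_def)
  then have "composition_operator \<phi> (h2_fun a) = h2_fun \<beta>" by (rule ext)
  from that[OF \<beta>(1) this \<beta>(2)[unfolded C_def]] show ?thesis .
qed

lemma composition_diff:
  "composition_operator \<phi> (\<lambda>s. f s - g s) = (\<lambda>s. composition_operator \<phi> f s - composition_operator \<phi> g s)"
  by (auto simp: composition_operator_def)

text \<open>A weakly convergent subsequence of preimages has differences d whose weighted norms tend
  to 0, and \<open>composition_h2_fun\<close> bounds the distance of the images by these. The weak
  limit stays in the ball, so the image is compact itself and not merely relatively compact.\<close>

lemma compactin_image_ball:
  "compactin h2.mtopology (composition_operator \<phi> ` h2_fun ` {a \<in> square_summable. (\<Sum>n. (cmod (a n))\<^sup>2) \<le> C})"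
  (is "compactin _ ?K")
  unfolding h2.compactin_sequentially
proof (intro conjI allI impI)
  have mem: "composition_operator \<phi> (h2_fun a) \<in> H2" if ss: "a \<in> square_summable" for a
  proof -
    obtain b where "b \<in> square_summable" "composition_operator \<phi> (h2_fun a) = h2_fun b"
      by (rule composition_h2_fun[OF ss])
    then show ?thesis by (simp add: H2_def)
  qed
  then show "?K \<subseteq> H2" by auto
  fix f :: "nat \<Rightarrow> complex \<Rightarrow> complex"
  assume f: "range f \<subseteq> ?K"
  have "\<exists>a. a \<in> square_summable \<and> (\<Sum>n. (cmod (a n))\<^sup>2) \<le> C \<and> f j = composition_operator \<phi> (h2_fun a)" for j
    using f by blast
  then obtain a where a: "\<And>j. a j \<in> square_summable" "\<And>j. (\<Sum>n. (cmod (a j n))\<^sup>2) \<le> C"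
    and f_eq: "\<And>j. f j = composition_operator \<phi> (h2_fun (a j))" by metis
  obtain r \<alpha> where r: "strict_mono r" and \<alpha>: "\<alpha> \<in> square_summable" "(\<Sum>n. (cmod (\<alpha> n))\<^sup>2) \<le> C"
    and lim: "\<And>n. (\<lambda>j. a (r j) n) \<longlonglongrightarrow> \<alpha> n"
    by (rule square_summable_weak_subsequence[of a C, OF a], rule that)
  define d where "d = (\<lambda>j n. a (r j) n - \<alpha> n)"
  have d: "d j \<in> square_summable" for j unfolding d_def by (rule square_summable_diff[OF a(1) \<alpha>(1)])
  have dC: "(\<Sum>n. (cmod (d j n))\<^sup>2) \<le> 4 * C" for j
    unfolding d_def by (rule l2_diff_bounds[OF a \<alpha>])
  have d0: "(\<lambda>j. d j n) \<longlonglongrightarrow> 0" for n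
    using tendsto_diff[OF lim[of n] tendsto_const[of "\<alpha> n"]] by (simp add: d_def)
  note W = weighted_l2_tendsto_0[OF d dC d0 powr_neg_tendsto_0[OF \<delta>_pos] powr_ge_zero]
  have bd: "h2_dist (f (r j)) (composition_operator \<phi> (h2_fun \<alpha>)) \<le>
      sqrt (\<Sum>n. (cmod (d j n))\<^sup>2 * real n powr (- 2 * \<delta>))" for j
  proof -
    obtain b where b: "b \<in> square_summable" "composition_operator \<phi> (h2_fun (d j)) = h2_fun b"
      "(\<Sum>n. (cmod (b n))\<^sup>2) \<le> (\<Sum>n. (cmod (d j n))\<^sup>2 * real n powr (- 2 * \<delta>))"
      using composition_h2_fun[OF d] .
    have "h2_dist (f (r j)) (composition_operator \<phi> (h2_fun \<alpha>)) = h2_norm (h2_fun b)"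
      unfolding h2_dist_def f_eq composition_diff[symmetric] h2_fun_diff[OF a(1) \<alpha>(1), symmetric]
      using b(2) by (simp add: d_def)
    then show ?thesis using b by (simp add: h2_norm_h2_fun)
  qed
  have "(\<lambda>j. sqrt (\<Sum>n. (cmod (d j n))\<^sup>2 * real n powr (- 2 * \<delta>))) \<longlonglongrightarrow> 0"
    using tendsto_real_sqrt[OF W(2)] by simp
  then have "(\<lambda>j. h2_dist (f (r j)) (composition_operator \<phi> (h2_fun \<alpha>))) \<longlonglongrightarrow> 0"
    by (rule Lim_null_comparison[OF always_eventually, rotated]) (use bd in simp)
  then have "limitin h2.mtopology (f \<circ> r) (composition_operator \<phi> (h2_fun \<alpha>)) sequentially"
    using mem a(1) \<alpha>(1) by (simp add: h2.limitin_metric_dist_null f_eq)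
  then show "\<exists>l r. l \<in> ?K \<and> strict_mono r \<and> limitin h2.mtopology (f \<circ> r) l sequentially"
    using r \<alpha> by blast
qed

text \<open>A bounded set lies in a ball, whose image is compact and hence closed in a Hausdorff
  space; the closure of the image of the bounded set is therefore a closed subset of a compact
  set.\<close>

lemma compact_composition_operator: "h2_compact_operator (composition_operator \<phi>)"
  unfolding h2_compact_operator_def
proof (intro conjI allI impI ballI)
  show "composition_operator \<phi> \<in> H2 \<rightarrow> H2"
  proof
    fix f assume "f \<in> H2"
    then obtain a where a: "a \<in> square_summable" "f = h2_fun a" by (auto simp: H2_def)
    obtain b where "b \<in> square_summable" "composition_operator \<phi> (h2_fun a) = h2_fun b"
      by (rule composition_h2_fun[OF a(1)])
    then show "composition_operator \<phi> f \<in> H2" using a(2) by (simp add: H2_def)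
  qed
  show "composition_operator \<phi> (\<lambda>s. x * f s + y * g s) =
      (\<lambda>s. x * composition_operator \<phi> f s + y * composition_operator \<phi> g s)" for f g x y
    by (auto simp: composition_operator_def)
  fix B assume B: "h2.mbounded B"
  let ?K = "\<lambda>C. composition_operator \<phi> ` h2_fun ` {a \<in> square_summable. (\<Sum>n. (cmod (a n))\<^sup>2) \<le> C}"
  have zero: "(\<lambda>s. 0) \<in> H2" using zero_square_summable h2_fun_zero by (metis H2_def image_eqI)
  \<comment> \<open>Metric boundedness controls only mutual distances; adjoining 0 turns it into a
    norm bound.\<close>
  have "h2.mbounded (insert (\<lambda>s. 0) B)" using B zero by (simp add: h2.mbounded_insert)
  then obtain R where R: "B \<subseteq> H2" "\<And>f. f \<in> B \<Longrightarrow> h2_dist f (\<lambda>s. 0) \<le> R"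
    unfolding h2.mbounded_alt by blast
  have "composition_operator \<phi> ` B \<subseteq> ?K (R\<^sup>2)"
  proof (intro image_mono subsetI)
    fix f assume f: "f \<in> B"
    then obtain a where a: "a \<in> square_summable" "f = h2_fun a" using R(1) by (auto simp: H2_def)
    have "h2_norm f \<le> R" using R(2)[OF f] by (simp add: h2_dist_def)
    then have "(h2_norm f)\<^sup>2 \<le> R\<^sup>2" by (intro power_mono h2_norm_nonneg)
    then show "f \<in> h2_fun ` {a \<in> square_summable. (\<Sum>n. (cmod (a n))\<^sup>2) \<le> R\<^sup>2}"
      using a by (auto simp: h2_norm_square)
  qed
  moreover have "closedin h2.mtopology (?K (R\<^sup>2))"
    by (rule compactin_imp_closedin[OF h2.Hausdorff_space_mtopology compactin_image_ball])
  ultimately have "h2.mtopology closure_of (composition_operator \<phi> ` B) \<subseteq> ?K (R\<^sup>2)"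
    by (rule closure_of_minimal)
  then show "compactin h2.mtopology (h2.mtopology closure_of (composition_operator \<phi> ` B))"
    by (rule closed_compactin[OF compactin_image_ball]) simp
qed

end

subsection \<open>Finitely generated multiplicative semigroups\<close>

text \<open>The integers with no prime factor above M. Adjoining the generators 1 to M one at a time
  supports induction; since they are not multiplicatively independent, the parametrisation by
  exponents is not injective.\<close>

fun generated_semigroup :: "nat \<Rightarrow> nat set" where
  "generated_semigroup 0 = {1}"
| "generated_semigroup (Suc k) = (\<lambda>(n, e). n * Suc k ^ e) ` (generated_semigroup k \<times> UNIV)"

lemma mult_semigroup_generated: "mult_semigroup (generated_semigroup M)"
proof (induction M)
  case 0
  show ?case by unfold_locales auto
next
  case (Suc M)
  interpret mult_semigroup "generated_semigroup M" by (rule Suc)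
  show ?case
  proof
    show "0 < n" if "n \<in> generated_semigroup (Suc M)" for n
      using that pos by auto
    show "1 \<in> generated_semigroup (Suc M)"
      using one_mem by (auto intro!: image_eqI[of _ _ "(1, 0)"])
    fix m n assume "m \<in> generated_semigroup (Suc M)" "n \<in> generated_semigroup (Suc M)"
    then obtain m' e n' e' where "m = m' * Suc M ^ e" "n = n' * Suc M ^ e'"
      and mem: "m' \<in> generated_semigroup M" "n' \<in> generated_semigroup M" by auto
    then have "m * n = (m' * n') * Suc M ^ (e + e')"
      by (simp add: power_add mult_ac del: power_Suc)
    then show "m * n \<in> generated_semigroup (Suc M)"
      using mult_mem[OF mem] by (auto intro!: image_eqI[of _ _ "(m' * n', e + e')"])
  qed
qed

lemma generated_semigroup_mono: "k \<le> M \<Longrightarrow> generated_semigroup k \<subseteq> generated_semigroup M"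
proof (induction M rule: dec_induct)
  case (step n)
  then show ?case by (fastforce intro: image_eqI[of _ _ "(_, 0)"])
qed simp

lemma generators_mem: "{1..M} \<subseteq> generated_semigroup M"
proof
  fix n assume n: "n \<in> {1..M}"
  then obtain k where k: "n = Suc k" by (cases n) auto
  have "1 \<in> generated_semigroup k" using mult_semigroup.one_mem[OF mult_semigroup_generated] .
  then have "n \<in> generated_semigroup (Suc k)"
    unfolding k by (auto intro!: image_eqI[of _ _ "(1, 1)"])
  then show "n \<in> generated_semigroup M" using generated_semigroup_mono[of "Suc k" M] k n by auto
qed

text \<open>Division of each generator's exponent by m: the quotients form q and the remainders form
  r, which has finitely many possible values.\<close>

lemma generated_semigroup_roots:
  assumes m: "0 < m"
  obtains R where "finite R" "R \<subseteq> {0<..}"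
    "\<And>n. n \<in> generated_semigroup M \<Longrightarrow> \<exists>q\<in>generated_semigroup M. \<exists>r\<in>R. n = q ^ m * r"
proof (induction M arbitrary: thesis)
  case 0
  show ?case by (rule 0[of "{1}"]) auto
next
  case (Suc M)
  obtain R where R: "finite R" "R \<subseteq> {0<..}"
    "\<And>n. n \<in> generated_semigroup M \<Longrightarrow> \<exists>q\<in>generated_semigroup M. \<exists>r\<in>R. n = q ^ m * r"
    using Suc.IH by blast
  show ?case
  proof (rule Suc.prems[of "(\<lambda>(r, j). r * Suc M ^ j) ` (R \<times> {..<m})"])
    show "finite ((\<lambda>(r, j). r * Suc M ^ j) ` (R \<times> {..<m}))" using R(1) by simp
    show "(\<lambda>(r, j). r * Suc M ^ j) ` (R \<times> {..<m}) \<subseteq> {0<..}" using R(2) by auto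
    fix n assume "n \<in> generated_semigroup (Suc M)"
    then obtain n' e where n: "n = n' * Suc M ^ e" "n' \<in> generated_semigroup M" by auto
    obtain q r where qr: "q \<in> generated_semigroup M" "r \<in> R" "n' = q ^ m * r" using R(3)[OF n(2)] by blast
    have "Suc M ^ e = (Suc M ^ (e div m)) ^ m * Suc M ^ (e mod m)"
      by (metis div_mult_mod_eq power_add power_mult)
    then have "n = (q * Suc M ^ (e div m)) ^ m * (r * Suc M ^ (e mod m))"
      by (simp add: n(1) qr(3) power_mult_distrib mult_ac del: power_Suc)
    moreover have "q * Suc M ^ (e div m) \<in> generated_semigroup (Suc M)"
      using qr(1) by (auto intro!: image_eqI[of _ _ "(q, e div m)"])
    moreover have "r * Suc M ^ (e mod m) \<in> (\<lambda>(r, j). r * Suc M ^ j) ` (R \<times> {..<m})"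
      using qr(2) m by (auto intro!: image_eqI[of _ _ "(r, e mod m)"])
    ultimately show "\<exists>q\<in>generated_semigroup (Suc M). \<exists>r\<in>(\<lambda>(r, j). r * Suc M ^ j) ` (R \<times> {..<m}). n = q ^ m * r"
      by blast
  qed
qed

section \<open>Zeta sums over the semigroup: convergence, doubling and blow-up\<close>

lemma summable_on_image_nonneg:
  fixes f :: "'b \<Rightarrow> real"
  assumes "(f \<circ> h) summable_on A"
  shows "f summable_on (h ` A)"
proof -
  \<comment> \<open>Choosing one preimage per image point removes the multiplicities, so that
    reindexing becomes possible.\<close>
  obtain B where B: "B \<subseteq> A" "inj_on h B" "h ` A = h ` B"
    using subset_image_inj[of "h ` A" h A] by auto
  have "(f \<circ> h) summable_on B" by (rule summable_on_subset_banach[OF assms B(1)])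
  then show ?thesis unfolding B(3) by (simp add: summable_on_reindex[OF B(2)])
qed

text \<open>Each new generator contributes at most a geometric series with ratio z < 1, as in a
  finite Euler product. Repeated representations only enlarge the sum over pairs.\<close>

lemma generated_semigroup_summable:
  assumes x: "0 < (x :: real)"
  shows "(\<lambda>n. real n powr - x) summable_on generated_semigroup M"
proof (induction M)
  case 0
  show ?case by simp
next
  case (Suc M)
  show ?case
  \<comment> \<open>The first generator adjoined is 1, for which the ratio would be 1; it adds no
    element.\<close>
  proof (cases "M = 0")
    case True
    then have "generated_semigroup (Suc M) = {1}" by auto
    then show ?thesis by simp
  next
    case False
    define z where "z = real (Suc M) powr - x"
    have z: "0 \<le> z" "z < 1" using False x by (auto simp: z_def powr_less_one)
    have "(\<lambda>(n, e). real n powr - x * z ^ e) summable_on generated_semigroup M \<times> (UNIV :: nat set)"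
    proof (rule summable_on_SigmaI)
      have "summable (\<lambda>e. norm (z ^ e))" using z by (simp add: summable_geometric)
      then have "((\<lambda>e. z ^ e) has_sum (1 / (1 - z))) UNIV"
        using z by (intro norm_summable_imp_has_sum geometric_sums) auto
      from has_sum_cmult_right[OF this]
      show "((\<lambda>e. case (n, e) of (n, e) \<Rightarrow> real n powr - x * z ^ e) has_sum
          real n powr - x * (1 / (1 - z))) UNIV" for n
        by simp
      show "(\<lambda>n. real n powr - x * (1 / (1 - z))) summable_on generated_semigroup M"
        by (rule summable_on_cmult_left[OF Suc])
    qed (use z in auto)
    moreover have "(\<lambda>n. real n powr - x) \<circ> (\<lambda>(n, e). n * Suc M ^ e) = (\<lambda>(n, e). real n powr - x * z ^ e)"
    proof -
      have "real (n * Suc M ^ e) powr - x = real n powr - x * z ^ e" for n e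
        by (simp add: z_def powr_mult powr_powr mult.commute flip: powr_realpow)
      then show ?thesis by (auto simp del: of_nat_mult of_nat_power)
    qed
    ultimately show ?thesis
      unfolding generated_semigroup.simps by (intro summable_on_image_nonneg) simp
  qed
qed

text \<open>At x = 2 * Re w this is the squared norm of the reproducing kernel at w for series with
  frequencies in the semigroup; it is finite for all x > 0, not only for x > 1.\<close>

definition partial_zeta :: "nat \<Rightarrow> real \<Rightarrow> real" where
  "partial_zeta M x = (\<Sum>\<^sub>\<infinity>n\<in>generated_semigroup M. real n powr - x)"

lemma partial_zeta_ge:
  assumes "0 < x" "finite F" "F \<subseteq> generated_semigroup M"
  shows "(\<Sum>n\<in>F. real n powr - x) \<le> partial_zeta M x"
  unfolding partial_zeta_def
  by (rule finite_sum_le_infsum[OF generated_semigroup_summable[OF assms(1)] assms(2,3)]) simp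

lemma partial_zeta_pos:
  assumes "0 < x"
  shows "0 < partial_zeta M x"
proof -
  have "1 \<in> generated_semigroup M" using mult_semigroup.one_mem[OF mult_semigroup_generated] .
  then have "(\<Sum>n\<in>{1}. real n powr - x) \<le> partial_zeta M x" by (intro partial_zeta_ge assms) auto
  then show ?thesis by simp
qed

lemma partial_zeta_antimono:
  assumes "0 < x" "x \<le> y"
  shows "partial_zeta M y \<le> partial_zeta M x"
  unfolding partial_zeta_def
proof (rule infsum_mono)
  fix n assume "n \<in> generated_semigroup M"
  then have "0 < n" by (rule mult_semigroup.pos[OF mult_semigroup_generated])
  then show "real n powr - y \<le> real n powr - x" using assms by (intro powr_mono) auto
qed (use assms in \<open>auto intro: generated_semigroup_summable\<close>)

text \<open>Write n = q^m * r as in \<open>generated_semigroup_roots\<close>. Since r \<ge> 1, the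
  term n^(-x) is at most q^(-m x), and each q serves at most \<open>card R\<close> values of n
  because the pair (q, r) determines n.\<close>

lemma partial_zeta_doubling:
  assumes m: "0 < m"
  obtains K where "0 < K" "\<And>x. 0 < x \<Longrightarrow> partial_zeta M x \<le> K * partial_zeta M (real m * x)"
proof -
  interpret mult_semigroup "generated_semigroup M" by (rule mult_semigroup_generated)
  obtain R where R: "finite R" "R \<subseteq> {0<..}"
    "\<And>n. n \<in> generated_semigroup M \<Longrightarrow> \<exists>q\<in>generated_semigroup M. \<exists>r\<in>R. n = q ^ m * r"
    using generated_semigroup_roots[OF m] by metis
  have "\<exists>q r. n \<in> generated_semigroup M \<longrightarrow> q \<in> generated_semigroup M \<and> r \<in> R \<and> n = q ^ m * r" for n
    using R(3) by blast
  then obtain q r where qr: "\<And>n. n \<in> generated_semigroup M \<Longrightarrow>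
      q n \<in> generated_semigroup M \<and> r n \<in> R \<and> n = q n ^ m * r n" by metis
  have "partial_zeta M x \<le> real (card R) * partial_zeta M (real m * x)" if x: "0 < x" for x
    unfolding partial_zeta_def[of M x]
  proof (rule infsum_le_finite_sums[OF generated_semigroup_summable[OF x]])
    fix F assume F: "finite F" "F \<subseteq> generated_semigroup M"
    have "(\<Sum>n\<in>F. real n powr - x) \<le> (\<Sum>n\<in>F. real (q n) powr - (real m * x))"
    proof (rule sum_mono)
      fix n assume "n \<in> F"
      then have n: "n \<in> generated_semigroup M" using F by auto
      have q0: "0 < q n" and r0: "0 < r n" using qr[OF n] pos R(2) by auto
      have "q n ^ m * 1 \<le> q n ^ m * r n" using r0 by (intro mult_le_mono) auto
      then have "real (q n ^ m) \<le> real n" using qr[OF n] by (metis mult.right_neutral of_nat_le_iff)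
      then have "real n powr - x \<le> real (q n ^ m) powr - x"
        using x q0 by (intro powr_mono2') auto
      also have "\<dots> = real (q n) powr - (real m * x)"
        using q0 by (simp add: powr_powr flip: powr_realpow)
      finally show "real n powr - x \<le> real (q n) powr - (real m * x)" .
    qed
    also have "\<dots> = (\<Sum>z\<in>(\<lambda>n. (q n, r n)) ` F. real (fst z) powr - (real m * x))"
    proof (subst sum.reindex)
      show "inj_on (\<lambda>n. (q n, r n)) F"
      proof (rule inj_onI)
        fix a b assume ab: "a \<in> F" "b \<in> F" "(q a, r a) = (q b, r b)"
        then have "a = q a ^ m * r a" "b = q b ^ m * r b" using qr F by blast+
        then show "a = b" using ab(3) by simp
      qed
    qed (simp add: o_def)
    also have "\<dots> \<le> (\<Sum>z\<in>(q ` F) \<times> R. real (fst z) powr - (real m * x))"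
      using F R(1) qr by (intro sum_mono2) auto
    also have "\<dots> = (\<Sum>k\<in>q ` F. \<Sum>r\<in>R. real k powr - (real m * x))"
      by (subst sum.cartesian_product) (simp add: case_prod_beta)
    also have "\<dots> = real (card R) * (\<Sum>k\<in>q ` F. real k powr - (real m * x))"
      by (simp add: sum_distrib_left)
    also have "\<dots> \<le> real (card R) * partial_zeta M (real m * x)"
      using F qr x m by (intro mult_left_mono partial_zeta_ge) auto
    finally show "(\<Sum>n\<in>F. real n powr - x) \<le> real (card R) * partial_zeta M (real m * x)" .
  qed
  moreover have "0 < real (card R)"
    using R(1) R(3)[OF one_mem] by (auto simp: card_gt_0_iff)
  ultimately show ?thesis using that by blast
qed

text \<open>The first K powers of 2 contribute K terms, each tending to 1 as x tends to 0.\<close>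

lemma partial_zeta_at_top:
  assumes M: "2 \<le> M"
  shows "filterlim (partial_zeta M) at_top (at_right 0)"
  unfolding filterlim_at_top
proof
  fix B :: real
  obtain K :: nat where K: "B < real K" using reals_Archimedean2 by blast
  interpret mult_semigroup "generated_semigroup M" by (rule mult_semigroup_generated)
  define F where "F = power (2 :: nat) ` {..<K}"
  have "2 \<in> generated_semigroup M" using generators_mem[of M] M by auto
  then have F: "finite F" "F \<subseteq> generated_semigroup M" unfolding F_def using power_mem by auto
  have card: "card F = K" unfolding F_def by (subst card_image) (auto simp: inj_on_def)
  have F0: "n \<noteq> 0" if "n \<in> F" for n using that by (auto simp: F_def)
  have "((\<lambda>x. \<Sum>n\<in>F. real n powr - x) \<longlongrightarrow> (\<Sum>n\<in>F. real n powr - 0)) (at_right 0)"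
    using F0 by (intro tendsto_intros) auto
  then have "((\<lambda>x. \<Sum>n\<in>F. real n powr - x) \<longlongrightarrow> real K) (at_right 0)"
    using F0 by (simp add: card)
  then have "\<forall>\<^sub>F x in at_right 0. B < (\<Sum>n\<in>F. real n powr - x)" using K by (rule order_tendstoD)
  then show "\<forall>\<^sub>F x in at_right 0. B \<le> partial_zeta M x"
    using eventually_at_right_less
  proof eventually_elim
    case (elim x)
    then show ?case using partial_zeta_ge[OF _ F, of x] by simp
  qed
qed

subsection \<open>Unrestricted range excludes compactness\<close>

lemma l2_tail_le:
  assumes \<beta>: "\<beta> \<in> square_summable" and \<epsilon>: "0 < \<epsilon>"
  obtains K where "(\<lambda>n. if n < K then 0 else \<beta> n) \<in> square_summable"
    "sqrt (\<Sum>n. (cmod (if n < K then 0 else \<beta> n))\<^sup>2) \<le> \<epsilon>"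
proof -
  have s: "summable (\<lambda>n. (cmod (\<beta> n))\<^sup>2)" using \<beta> by (simp add: square_summable_def)
  from suminf_exist_split[OF _ s, of "\<epsilon>\<^sup>2"] \<epsilon>
  obtain K where K: "\<And>n. n \<ge> K \<Longrightarrow> norm (\<Sum>i. (cmod (\<beta> (i + n)))\<^sup>2) < \<epsilon>\<^sup>2" by auto
  have s': "summable (\<lambda>n. (cmod (if n < K then 0 else \<beta> n))\<^sup>2)"
    by (rule summable_comparison_test'[OF s]) auto
  have "(\<Sum>n. (cmod (if n < K then 0 else \<beta> n))\<^sup>2) = (\<Sum>i. (cmod (\<beta> (i + K)))\<^sup>2)"
    by (subst suminf_split_initial_segment[OF s', of K]) simp
  also have "\<dots> \<le> \<epsilon>\<^sup>2" using K[of K] by simp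
  finally have "sqrt (\<Sum>n. (cmod (if n < K then 0 else \<beta> n))\<^sup>2) \<le> \<epsilon>"
    using \<epsilon> by (simp add: real_le_lsqrt)
  moreover have "(\<lambda>n. if n < K then 0 else \<beta> n) \<in> square_summable"
    using s' \<beta> by (simp add: square_summable_def)
  ultimately show ?thesis using that by blast
qed

text \<open>Convergence at s = 0 makes the coefficients absolutely summable; they are eventually
  below 1, where squaring decreases them.\<close>

lemma (in mult_semigroup) entire_dirichlet_imp_square_summable:
  assumes b: "entire_dirichlet S b F"
  shows "b \<in> square_summable"
proof -
  have b0: "b 0 = 0" using b pos[of 0] by (auto simp: entire_dirichlet_def)
  have "((\<lambda>k. b k * of_nat k powr (- 0)) has_sum F 0) UNIV" using b unfolding entire_dirichlet_def by blast
  moreover have "(\<lambda>k. b k * of_nat k powr (- 0)) = b" using b0 by (auto simp: fun_eq_iff powr_def)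
  ultimately have "b summable_on UNIV" by (auto intro: has_sum_imp_summable)
  then have s: "summable (\<lambda>k. cmod (b k))"
    by (simp add: summable_on_iff_abs_summable_on_complex summable_on_imp_summable)
  have "\<forall>\<^sub>F k in sequentially. cmod (b k) < 1"
    using order_tendstoD(2)[OF summable_LIMSEQ_zero[OF s]] by simp
  then have "\<forall>\<^sub>F k in sequentially. norm ((cmod (b k))\<^sup>2) \<le> cmod (b k)"
    by (rule eventually_mono) (simp add: power2_eq_square mult_left_le)
  then have "summable (\<lambda>k. (cmod (b k))\<^sup>2)" by (rule summable_comparison_test_ev[OF _ s])
  with b0 show ?thesis by (simp add: square_summable_def)
qed

lemma mbounded_l2_ball: "h2.mbounded (h2_fun ` {a \<in> square_summable. (\<Sum>n. (cmod (a n))\<^sup>2) \<le> C})"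
  unfolding h2.mbounded_alt
proof (intro conjI exI ballI)
  show "h2_fun ` {a \<in> square_summable. (\<Sum>n. (cmod (a n))\<^sup>2) \<le> C} \<subseteq> H2" by (auto simp: H2_def)
  fix f g assume "f \<in> h2_fun ` {a \<in> square_summable. (\<Sum>n. (cmod (a n))\<^sup>2) \<le> C}"
    "g \<in> h2_fun ` {a \<in> square_summable. (\<Sum>n. (cmod (a n))\<^sup>2) \<le> C}"
  then show "h2_dist f g \<le> sqrt (4 * C)"
    by (auto simp: h2_dist_h2_fun l2_diff_bounds simp del: real_sqrt_le_iff intro!: real_sqrt_le_mono)
qed

lemma generated_kernel_series:
  fixes w :: complex and M :: nat
  assumes "0 < Re w"
  defines "\<kappa> \<equiv> \<lambda>k. if k \<in> generated_semigroup M then of_nat k powr (- w) else 0"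
  shows "(\<lambda>k. (cmod (\<kappa> k))\<^sup>2) sums partial_zeta M (2 * Re w)"
proof (rule has_sum_imp_sums)
  have "((\<lambda>n. real n powr - (2 * Re w)) has_sum partial_zeta M (2 * Re w)) (generated_semigroup M)"
    unfolding partial_zeta_def
    using assms by (intro has_sum_infsum generated_semigroup_summable) simp
  also have "?this \<longleftrightarrow> ((\<lambda>k. (cmod (\<kappa> k))\<^sup>2) has_sum partial_zeta M (2 * Re w)) UNIV"
  proof (rule has_sum_cong_neutral)
    fix k assume "k \<in> generated_semigroup M \<inter> UNIV"
    then have k: "k \<in> generated_semigroup M" "0 < k"
      using mult_semigroup.pos[OF mult_semigroup_generated] by auto
    then have "cmod (of_nat k powr (- w)) = real k powr (- Re w)"
      by (subst norm_powr_real_powr) auto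
    then show "real k powr - (2 * Re w) = (cmod (\<kappa> k))\<^sup>2"
      using k(1) by (simp add: \<kappa>_def power2_eq_square flip: powr_add)
  qed (auto simp: \<kappa>_def)
  finally show "((\<lambda>k. (cmod (\<kappa> k))\<^sup>2) has_sum partial_zeta M (2 * Re w)) UNIV" .
qed

text \<open>Meant for b close to a fixed \<beta>. Split b into b - \<beta>, the tail of \<beta> and
  its head. Cauchy-Schwarz against the kernel \<kappa> bounds the first two pieces, while |\<kappa>|
  \<le> 1 bounds the head independently of w, so the head is negligible once the kernel norm is
  large.\<close>

lemma norm_entire_dirichlet_le:
  assumes b: "entire_dirichlet (generated_semigroup M) b F"
    and \<beta>: "\<beta> \<in> square_summable"
    and tail: "(\<lambda>n. if n < K then 0 else \<beta> n) \<in> square_summable"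
    and w: "0 < Re w"
  shows "cmod (F w) \<le> (sqrt (\<Sum>n. (cmod (b n - \<beta> n))\<^sup>2) + sqrt (\<Sum>n. (cmod (if n < K then 0 else \<beta> n))\<^sup>2)) *
    sqrt (partial_zeta M (2 * Re w)) + (\<Sum>n<K. cmod (\<beta> n))"
proof -
  interpret mult_semigroup "generated_semigroup M" by (rule mult_semigroup_generated)
  define \<kappa> where "\<kappa> = (\<lambda>k. if k \<in> generated_semigroup M then of_nat k powr (- w) else 0)"
  have \<kappa>: "(\<lambda>k. (cmod (\<kappa> k))\<^sup>2) sums partial_zeta M (2 * Re w)"
    unfolding \<kappa>_def by (rule generated_kernel_series[OF w])
  define d where "d = (\<lambda>n. b n - \<beta> n)"
  define t where "t = (\<lambda>n. if n < K then 0 else \<beta> n)"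
  define p where "p = (\<lambda>n. if n < K then \<beta> n else 0)"
  have ss: "summable (\<lambda>n. (cmod (d n))\<^sup>2)" "summable (\<lambda>n. (cmod (t n))\<^sup>2)"
    using square_summable_diff[OF entire_dirichlet_imp_square_summable[OF b] \<beta>] tail
    by (auto simp: d_def t_def square_summable_def)
  note CS = l2_Cauchy_Schwarz[OF ss(1) sums_summable[OF \<kappa>]] l2_Cauchy_Schwarz[OF ss(2) sums_summable[OF \<kappa>]]
  have "cmod (\<kappa> n) \<le> 1" for n
  proof (cases "n \<in> generated_semigroup M")
    case True
    then have "1 \<le> real n" using pos by fastforce
    then have "real n powr (- Re w) \<le> real n powr 0" using w by (intro powr_mono) auto
    moreover have "cmod (of_nat n powr (- w)) = real n powr (- Re w)"
      by (subst norm_powr_real_powr) auto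
    ultimately show ?thesis using True \<open>1 \<le> real n\<close> by (simp add: \<kappa>_def)
  qed (simp add: \<kappa>_def)
  then have "cmod (\<Sum>n<K. \<beta> n * \<kappa> n) \<le> (\<Sum>n<K. cmod (\<beta> n))"
    by (intro order_trans[OF norm_sum] sum_mono) (simp add: norm_mult mult_left_le)
  moreover have "F w = (\<Sum>n. d n * \<kappa> n) + (\<Sum>n. t n * \<kappa> n) + (\<Sum>n<K. \<beta> n * \<kappa> n)"
  proof -
    have "(\<lambda>n. p n * \<kappa> n) sums (\<Sum>n<K. p n * \<kappa> n)"
      by (rule sums_finite) (auto simp: p_def)
    moreover have "(\<Sum>n<K. p n * \<kappa> n) = (\<Sum>n<K. \<beta> n * \<kappa> n)" by (simp add: p_def)
    ultimately have "(\<lambda>n. d n * \<kappa> n + t n * \<kappa> n + p n * \<kappa> n) sums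
        ((\<Sum>n. d n * \<kappa> n) + (\<Sum>n. t n * \<kappa> n) + (\<Sum>n<K. \<beta> n * \<kappa> n))"
      using CS(1,3) by (intro sums_add summable_sums) auto
    moreover have "d n * \<kappa> n + t n * \<kappa> n + p n * \<kappa> n = b n * of_nat n powr (- w)" for n
      using b by (auto simp: d_def t_def p_def \<kappa>_def entire_dirichlet_def algebra_simps)
    moreover have "(\<lambda>n. b n * of_nat n powr (- w)) sums F w"
      using b by (auto simp: entire_dirichlet_def intro: has_sum_imp_sums)
    ultimately show ?thesis by (simp add: sums_unique2)
  qed
  ultimately show ?thesis
    using CS(2,4) norm_triangle_ineq[of "(\<Sum>n. d n * \<kappa> n) + (\<Sum>n. t n * \<kappa> n)" "\<Sum>n<K. \<beta> n * \<kappa> n"]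
      norm_triangle_ineq[of "\<Sum>n. d n * \<kappa> n" "\<Sum>n. t n * \<kappa> n"]
    unfolding sums_unique[OF \<kappa>, symmetric] d_def[symmetric] t_def[symmetric] distrib_right
    by (simp add: d_def t_def)
qed

text \<open>The test functions are normalised truncated reproducing kernels at \<open>\<phi> w\<close>, among the functions
  whose frequencies lie in the semigroup. Unlike those of the full space, these kernels live on the
  half-plane \<open>Re s > 0\<close>.\<close>

lemma (in polynomial_symbol) kernel_test_function:
  assumes S: "S = generated_semigroup M"
    and self_map: "\<phi> ` right_halfplane (1/2) \<subseteq> right_halfplane (1/2)"
    and w: "0 < Re (\<phi> w)"
  obtains a b F where "a \<in> square_summable" "(\<Sum>n. (cmod (a n))\<^sup>2) \<le> 1"
    "entire_dirichlet S b F" "composition_operator \<phi> (h2_fun a) = h2_fun b"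
    "sqrt (partial_zeta M (2 * Re (\<phi> w)) / 2) \<le> cmod (F w)"
proof -
  define v where "v = \<phi> w"
  define Z where "Z = partial_zeta M (2 * Re v)"
  have Z0: "0 < Z" unfolding Z_def by (rule partial_zeta_pos) (use w in \<open>simp add: v_def\<close>)
  have "((\<lambda>n. real n powr - (2 * Re v)) has_sum Z) S"
    unfolding Z_def partial_zeta_def S
    using w by (intro has_sum_infsum generated_semigroup_summable) (simp add: v_def)
  \<comment> \<open>A finite truncation retains more than half of the squared kernel norm. Finite
    support gives the composed function an entire formula, valid also where Re (\<phi> w) \<le>
    1/2.\<close>
  then have "\<forall>\<^sub>F A in finite_subsets_at_top S. Z / 2 < (\<Sum>n\<in>A. real n powr - (2 * Re v))"
    unfolding has_sum_def using Z0 by (intro order_tendstoD) auto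
  then obtain A where A: "finite A" "A \<subseteq> S" "Z / 2 < (\<Sum>n\<in>A. real n powr - (2 * Re v))"
    unfolding eventually_finite_subsets_at_top by blast
  define Q where "Q = (\<Sum>n\<in>A. real n powr - (2 * Re v))"
  have Q0: "0 < Q" using A(3) Z0 by (simp add: Q_def)
  \<comment> \<open>The kernel at v has coefficients n^(-cnj v); division by sqrt Q gives norm 1 and
    the value sqrt Q at v.\<close>
  define a where "a = (\<lambda>n. if n \<in> A then of_nat n powr (- cnj v) / of_real (sqrt Q) else 0)"
  have A0: "0 < n" if "n \<in> A" for n using that A(2) pos by auto
  obtain L where L: "A \<subseteq> {..L}" using A(1) by (meson finite_nat_set_iff_bounded_le atMost_iff subsetI)
  have A_sub: "A \<subseteq> {1..L}" using L A0 by force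
  have na: "(cmod (a n))\<^sup>2 = (if n \<in> A then real n powr - (2 * Re v) / Q else 0)" for n
  proof (cases "n \<in> A")
    case True
    have "cmod (of_nat n powr (- cnj v)) = real n powr (- Re v)"
      by (subst norm_powr_real_powr) (use A0[OF True] in auto)
    then show ?thesis using True Q0
      by (simp add: a_def norm_divide power_divide) (simp add: power2_eq_square flip: powr_add)
  qed (simp add: a_def)
  have "(\<lambda>n. (cmod (a n))\<^sup>2) sums (\<Sum>n\<in>A. (cmod (a n))\<^sup>2)"
    by (rule sums_finite[OF A(1)]) (simp add: a_def)
  moreover have "(\<Sum>n\<in>A. (cmod (a n))\<^sup>2) = 1"
    using Q0 by (simp add: na Q_def flip: sum_divide_distrib)
  ultimately have sa: "(\<lambda>n. (cmod (a n))\<^sup>2) sums 1" by simp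
  have a_ss: "a \<in> square_summable"
    using sums_summable[OF sa] A0[of 0] by (auto simp: square_summable_def a_def)
  obtain b where b: "entire_dirichlet S b (\<lambda>s. \<Sum>n=1..L. a n * of_nat n powr (- \<phi> s))"
  proof (rule entire_dirichlet_poly_symbol[of L a])
    show "n \<in> S \<or> a n = 0" if "n \<in> {1..L}" for n using A(2) by (auto simp: a_def)
  qed
  have poly: "dirichlet_series a z = (\<Sum>n=1..L. a n * of_nat n powr (- z))" for z
    unfolding dirichlet_series_def
    by (rule suminf_finite) (use A_sub in \<open>auto simp: a_def\<close>)
  have bs: "dirichlet_series b s = (\<Sum>n=1..L. a n * of_nat n powr (- \<phi> s))" for s
    using b by (auto simp: dirichlet_series_def entire_dirichlet_def
        intro!: sums_unique[symmetric] has_sum_imp_sums)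
  have comp: "composition_operator \<phi> (h2_fun a) = h2_fun b"
    using self_map by (auto simp: fun_eq_iff composition_operator_def h2_fun_def poly bs)
  have "(\<Sum>n=1..L. a n * of_nat n powr (- \<phi> w)) = (\<Sum>n\<in>A. a n * of_nat n powr (- v))"
    unfolding v_def by (rule sum.mono_neutral_right) (use A_sub in \<open>auto simp: a_def\<close>)
  also have "\<dots> = (\<Sum>n\<in>A. of_real (real n powr - (2 * Re v)) / of_real (sqrt Q))"
  proof (rule sum.cong[OF refl])
    fix n assume n: "n \<in> A"
    have exponents: "- (cnj v * of_real (ln (real n))) - v * of_real (ln (real n)) =
        of_real (- (2 * Re v * ln (real n)))"
      by (simp add: complex_eq_iff algebra_simps)
    have "of_nat n powr (- cnj v) * of_nat n powr (- v) = complex_of_real (real n powr - (2 * Re v))"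
      using A0[OF n] by (simp add: of_nat_powr_complex powr_def exponents flip: exp_add exp_of_real
          del: of_real_mult of_real_minus)
    then show "a n * of_nat n powr (- v) = of_real (real n powr - (2 * Re v)) / of_real (sqrt Q)"
      using n by (simp add: a_def)
  qed
  also have "\<dots> = of_real (Q / sqrt Q)"
    by (simp add: Q_def flip: sum_divide_distrib)
  also have "Q / sqrt Q = sqrt Q" using Q0 by (simp add: real_div_sqrt)
  finally have "cmod (\<Sum>n=1..L. a n * of_nat n powr (- \<phi> w)) = sqrt Q" using Q0 by simp
  moreover have "sqrt (Z / 2) \<le> sqrt Q" using A(3) by (simp add: Q_def)
  ultimately show ?thesis
    using that[OF a_ss _ b comp] sums_unique[OF sa] by (simp add: Z_def v_def)
qed

text \<open>Doubling turns Re (\<phi> w) \<le> m * Re w into |F (w)| \<ge> 2 \<epsilon> sqrt Z for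
  the images of the test functions. If a subsequence of the images converged to \<beta> in norm,
  \<open>norm_entire_dirichlet_le\<close> would bound the same values by (\<Delta> + \<epsilon>)
  sqrt Z + C with \<Delta> tending to 0, a contradiction as Z tends to infinity.\<close>

lemma (in polynomial_symbol) not_compact:
  assumes S: "S = generated_semigroup M" and M: "2 \<le> M"
    and self_map: "\<phi> ` right_halfplane (1/2) \<subseteq> right_halfplane (1/2)"
    and w: "\<And>j :: nat. 0 < Re (w j)" "(\<lambda>j. Re (w j)) \<longlonglongrightarrow> 0"
    and \<phi>w: "\<And>j. 0 < Re (\<phi> (w j))" "\<And>j. Re (\<phi> (w j)) \<le> real m * Re (w j)"
  shows "\<not> h2_compact_operator (composition_operator \<phi>)"
proof
  let ?T = "composition_operator \<phi>"
  let ?B = "h2_fun ` {a \<in> square_summable. (\<Sum>n. (cmod (a n))\<^sup>2) \<le> 1}"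
  assume "h2_compact_operator ?T"
  then have T: "?T \<in> H2 \<rightarrow> H2" and cpt: "compactin h2.mtopology (h2.mtopology closure_of (?T ` ?B))"
    using mbounded_l2_ball unfolding h2_compact_operator_def by blast+
  have "0 < m"
    using \<phi>w[of 0] by (cases m) auto
  then obtain D where D: "0 < D" "\<And>x. 0 < x \<Longrightarrow> partial_zeta M x \<le> D * partial_zeta M (real m * x)"
    using partial_zeta_doubling by blast
  define Z where "Z = (\<lambda>j. partial_zeta M (2 * Re (w j)))"
  have Z0: "0 < Z j" for j unfolding Z_def by (rule partial_zeta_pos) (simp add: w(1))
  have "\<forall>j. \<exists>a b F. a \<in> square_summable \<and> (\<Sum>n. (cmod (a n))\<^sup>2) \<le> 1 \<and>
    entire_dirichlet S b F \<and> ?T (h2_fun a) = h2_fun b \<and>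
    sqrt (partial_zeta M (2 * Re (\<phi> (w j))) / 2) \<le> cmod (F (w j))"
  proof
    fix j
    show "\<exists>a b F. a \<in> square_summable \<and> (\<Sum>n. (cmod (a n))\<^sup>2) \<le> 1 \<and>
      entire_dirichlet S b F \<and> ?T (h2_fun a) = h2_fun b \<and>
      sqrt (partial_zeta M (2 * Re (\<phi> (w j))) / 2) \<le> cmod (F (w j))"
      by (rule kernel_test_function[OF S self_map \<phi>w(1)[of j]]) blast
  qed
  then obtain a b F where a: "\<And>j. a j \<in> square_summable" "\<And>j. (\<Sum>n. (cmod (a j n))\<^sup>2) \<le> 1"
    and b: "\<And>j. entire_dirichlet S (b j) (F j)" and Ta: "\<And>j. ?T (h2_fun (a j)) = h2_fun (b j)"
    and F_ge: "\<And>j. sqrt (partial_zeta M (2 * Re (\<phi> (w j))) / 2) \<le> cmod (F j (w j))"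
    by metis
  have F_lower: "sqrt (1 / (2 * D)) * sqrt (Z j) \<le> cmod (F j (w j))" for j
  proof -
    have "Z j \<le> D * partial_zeta M (real m * (2 * Re (w j)))"
      unfolding Z_def by (rule D(2)) (simp add: w(1))
    also have "\<dots> \<le> D * partial_zeta M (2 * Re (\<phi> (w j)))"
      using D(1) \<phi>w[of j] by (intro mult_left_mono partial_zeta_antimono) auto
    finally have "1 / (2 * D) * Z j \<le> partial_zeta M (2 * Re (\<phi> (w j))) / 2"
      using D(1) by (simp add: field_simps)
    then have "sqrt (1 / (2 * D) * Z j) \<le> sqrt (partial_zeta M (2 * Re (\<phi> (w j))) / 2)"
      by (rule real_sqrt_le_mono)
    also note F_ge[of j]
    finally show ?thesis by (simp only: real_sqrt_mult)
  qed
  have "?B \<subseteq> H2" by (auto simp: H2_def)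
  then have "?T ` ?B \<subseteq> topspace h2.mtopology" using T by auto
  then have "?T ` ?B \<subseteq> h2.mtopology closure_of (?T ` ?B)" by (rule closure_of_subset)
  moreover have "h2_fun (b j) \<in> ?T ` ?B" for j
    unfolding Ta[symmetric] using a by blast
  ultimately have "range (\<lambda>j. h2_fun (b j)) \<subseteq> h2.mtopology closure_of (?T ` ?B)" by blast
  then obtain l r where l: "l \<in> h2.mtopology closure_of (?T ` ?B)" and r: "strict_mono (r :: nat \<Rightarrow> nat)"
    and lim: "limitin h2.mtopology ((\<lambda>j. h2_fun (b j)) \<circ> r) l sequentially"
    using cpt unfolding h2.compactin_sequentially by blast
  from lim obtain \<beta> where \<beta>: "\<beta> \<in> square_summable" "l = h2_fun \<beta>"
    unfolding h2.limitin_metric_dist_null by (auto simp: H2_def)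
  have b_ss: "b j \<in> square_summable" for j by (rule entire_dirichlet_imp_square_summable[OF b])
  define \<Delta> where "\<Delta> = (\<lambda>j. sqrt (\<Sum>n. (cmod (b (r j) n - \<beta> n))\<^sup>2))"
  have \<Delta>: "\<Delta> \<longlonglongrightarrow> 0"
    using lim unfolding h2.limitin_metric_dist_null \<Delta>_def by (simp add: \<beta>(2) h2_dist_h2_fun[OF b_ss \<beta>(1)])
  \<comment> \<open>Half of the constant in \<open>F_lower\<close>, so that a tail of size
    \<epsilon> still leaves a gap of \<epsilon>. The 2 under the root comes from the truncation of
    the kernels.\<close>
  define \<epsilon> where "\<epsilon> = sqrt (1 / (2 * D)) / 2"
  have \<epsilon>: "0 < \<epsilon>" using D(1) by (simp add: \<epsilon>_def)
  obtain K where tail: "(\<lambda>n. if n < K then 0 else \<beta> n) \<in> square_summable"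
    "sqrt (\<Sum>n. (cmod (if n < K then 0 else \<beta> n))\<^sup>2) \<le> \<epsilon>"
    using l2_tail_le[OF \<beta>(1) \<epsilon>] .
  define C where "C = (\<Sum>n<K. cmod (\<beta> n))"
  have "2 * \<epsilon> \<le> \<Delta> j + \<epsilon> + C / sqrt (Z (r j))" for j
  proof -
    have Zj: "0 < sqrt (Z (r j))" using Z0 by simp
    have "2 * \<epsilon> * sqrt (Z (r j)) \<le> cmod (F (r j) (w (r j)))"
      using F_lower[of "r j"] by (simp add: \<epsilon>_def)
    also have "\<dots> \<le> (\<Delta> j + sqrt (\<Sum>n. (cmod (if n < K then 0 else \<beta> n))\<^sup>2)) * sqrt (Z (r j)) + C"
      unfolding \<Delta>_def Z_def C_def
      by (rule norm_entire_dirichlet_le[OF b[unfolded S] \<beta>(1) tail(1) w(1)])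
    also have "\<dots> \<le> (\<Delta> j + \<epsilon>) * sqrt (Z (r j)) + C"
      using tail(2) Zj by (intro add_right_mono mult_right_mono) auto
    finally show ?thesis using Zj by (simp add: field_simps)
  qed
  moreover have "(\<lambda>j. \<Delta> j + \<epsilon> + C / sqrt (Z (r j))) \<longlonglongrightarrow> 0 + \<epsilon> + 0"
  proof (intro tendsto_add \<Delta> tendsto_const)
    have "filterlim (\<lambda>j. 2 * Re (w j)) (at_right 0) sequentially"
      using w(1) less_imp_neq[OF w(1)] tendsto_mult_left[OF w(2), of 2]
      by (auto simp: filterlim_at eventually_sequentially)
    then have "filterlim Z at_top sequentially"
      unfolding Z_def by (rule filterlim_compose[OF partial_zeta_at_top[OF M]])
    then have "filterlim (\<lambda>j. Z (r j)) at_top sequentially"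
      by (rule filterlim_compose[OF _ filterlim_subseq[OF r]])
    then have "filterlim (\<lambda>j. sqrt (Z (r j))) at_top sequentially"
      by (rule filterlim_compose[OF sqrt_at_top])
    then show "(\<lambda>j. C / sqrt (Z (r j))) \<longlonglongrightarrow> 0"
      by (intro tendsto_divide_0[OF tendsto_const] filterlim_at_top_imp_at_infinity)
  qed
  ultimately have "2 * \<epsilon> \<le> 0 + \<epsilon> + 0" by (intro LIMSEQ_le_const) auto
  then show False using \<epsilon> by simp
qed

section \<open>Horizontal displacement and the final equivalence\<close>

lemma norm_powr_diff_le:
  assumes "0 < n" "0 \<le> x" "0 \<le> y"
  shows "cmod (of_nat n powr (- Complex x t) - of_nat n powr (- Complex y t)) \<le> ln (real n) * \<bar>x - y\<bar>"
proof -
  have *: "exp (- u) - exp (- v) \<le> v - u" if "0 \<le> u" "u \<le> v" for u v :: real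
  proof -
    have "exp (- u) - exp (- v) = exp (- u) * (1 - exp (- (v - u)))"
      by (simp add: right_diff_distrib flip: exp_add)
    also have "\<dots> \<le> 1 * (v - u)"
    proof (intro mult_mono)
      show "1 - exp (- (v - u)) \<le> v - u" using exp_ge_add_one_self[of "- (v - u)"] by linarith
    qed (use that in auto)
    finally show ?thesis by simp
  qed
  \<comment> \<open>Equal imaginary parts allow a unimodular factor to be split off, leaving a
    difference of real decaying exponentials.\<close>
  have "of_nat n powr (- Complex x t) - of_nat n powr (- Complex y t) =
      cis (- t * ln (real n)) * of_real (exp (- (x * ln (real n))) - exp (- (y * ln (real n))))"
    using assms(1) by (simp add: of_nat_powr_complex cis_conv_exp algebra_simps Complex_eq flip: exp_add exp_of_real)
  then have "cmod (of_nat n powr (- Complex x t) - of_nat n powr (- Complex y t)) =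
      \<bar>exp (- (x * ln (real n))) - exp (- (y * ln (real n)))\<bar>"
    by (simp only: norm_mult norm_of_real norm_cis mult_1)
  also have "\<dots> \<le> \<bar>x * ln (real n) - y * ln (real n)\<bar>"
    using *[of "x * ln (real n)" "y * ln (real n)"] *[of "y * ln (real n)" "x * ln (real n)"] assms
    by (cases "x * ln (real n) \<le> y * ln (real n)") auto
  also have "\<dots> = ln (real n) * \<bar>x - y\<bar>"
    using assms(1) by (simp add: abs_mult mult.commute flip: left_diff_distrib)
  finally show ?thesis .
qed

text \<open>The constant C does not depend on the height t, which is essential since the points
  where Re \<phi> is small may escape vertically to infinity.\<close>

lemma (in polynomial_symbol) horizontal_Lipschitz:
  obtains C where "0 \<le> C"
    "\<And>x y t. 0 \<le> x \<Longrightarrow> 0 \<le> y \<Longrightarrow> cmod (\<phi> (Complex x t) - \<phi> (Complex y t)) \<le> C * \<bar>x - y\<bar>"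
proof
  define C where "C = real c0 + (\<Sum>n=2..N. cmod (c n) * ln (real n))"
  show "0 \<le> C" unfolding C_def by (intro add_nonneg_nonneg sum_nonneg mult_nonneg_nonneg) auto
  fix x y t :: real assume xy: "0 \<le> x" "0 \<le> y"
  have "\<phi> (Complex x t) - \<phi> (Complex y t) = of_nat c0 * of_real (x - y) +
      (\<Sum>n=2..N. c n * (of_nat n powr (- Complex x t) - of_nat n powr (- Complex y t)))"
    by (simp add: symbol right_diff_distrib sum_subtractf Complex_eq algebra_simps)
  also have "cmod \<dots> \<le> real c0 * \<bar>x - y\<bar> + (\<Sum>n=2..N. cmod (c n) * (ln (real n) * \<bar>x - y\<bar>))"
    by (intro order_trans[OF norm_triangle_ineq] add_mono order_trans[OF norm_sum] sum_mono)
      (auto simp: norm_mult simp flip: of_real_diff intro!: mult_left_mono norm_powr_diff_le xy)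
  also have "\<dots> = C * \<bar>x - y\<bar>"
    by (simp add: C_def distrib_right sum_distrib_right mult.assoc)
  finally show "cmod (\<phi> (Complex x t) - \<phi> (Complex y t)) \<le> C * \<bar>x - y\<bar>" .
qed

theorem theorem1:
  fixes c0 N :: nat and c :: "nat \<Rightarrow> complex" and \<phi> :: "complex \<Rightarrow> complex"
  assumes "\<And>s. \<phi> s = of_nat c0 * s + c 1 + (\<Sum>n=2..N. c n * of_nat n powr (- s))"
    and "\<phi> \<in> gordon_hedenmalm c0"
    and "c0 \<ge> 1"
  shows "h2_compact_operator (composition_operator \<phi>) \<longleftrightarrow> restricted_range c0 \<phi>"
proof -
  from assms(2) obtain d where self_map: "\<phi> ` right_halfplane (1/2) \<subseteq> right_halfplane (1/2)"
    and d: "\<And>s. s \<in> right_halfplane 0 \<Longrightarrow> \<phi> s = of_nat c0 * s + dirichlet_series d s"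
      "(\<forall>s\<in>right_halfplane 0. dirichlet_series d s = 0) \<or>
        dirichlet_series d ` right_halfplane 0 \<subseteq> right_halfplane 0"
    unfolding gordon_hedenmalm_def using assms(3) by auto
  have Re_ge: "real c0 * Re s \<le> Re (\<phi> s)" if "0 < Re s" for s
  proof -
    have s: "s \<in> right_halfplane 0" using that by (simp add: right_halfplane_def)
    then have "0 \<le> Re (dirichlet_series d s)" using d(2) by (fastforce simp: right_halfplane_def)
    then show ?thesis by (simp add: d(1)[OF s])
  qed
  have Re_\<phi>: "Re s \<le> Re (\<phi> s)" "0 < Re (\<phi> s)" if "0 < Re s" for s
  proof -
    have "Re s \<le> real c0 * Re s" using mult_right_mono[of 1 "real c0" "Re s"] assms(3) that by simp
    from order_trans[OF this Re_ge[OF that]] show "Re s \<le> Re (\<phi> s)" .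
    with that show "0 < Re (\<phi> s)" by (rule less_le_trans)
  qed
  define I where "I = (INF s\<in>right_halfplane 0. Re (\<phi> s))"
  have bdd: "bdd_below ((\<lambda>s. Re (\<phi> s)) ` right_halfplane 0)"
    using Re_\<phi>(2) by (intro bdd_belowI[of _ 0]) (auto simp: right_halfplane_def less_imp_le)
  have ne: "right_halfplane 0 \<noteq> {}" by (auto simp: right_halfplane_def intro: exI[of _ 1])
  have I0: "0 \<le> I"
    unfolding I_def using Re_\<phi>(2) by (intro cINF_greatest ne) (auto simp: right_halfplane_def less_imp_le)
  have restr: "restricted_range c0 \<phi> \<longleftrightarrow> I \<noteq> 0"
    using assms(3) by (simp add: restricted_range_def unrestricted_range_def I_def)
  show ?thesis
  proof (cases "I = 0")
    case False
    interpret compact_symbol c0 N c \<phi> I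
    proof
      show "I \<le> Re (\<phi> s)" if "0 < Re s" for s
        unfolding I_def using that by (intro cINF_lower bdd) (simp add: right_halfplane_def)
    qed (use assms self_map False I0 in auto)
    show ?thesis using compact_composition_operator restr False by simp
  next
    case True
    \<comment> \<open>N covers the frequencies of the symbol; the minimum 2 ensures that the zeta
      sum blows up at 0.\<close>
    define M where "M = max N 2"
    interpret mult_semigroup "generated_semigroup M" by (rule mult_semigroup_generated)
    interpret polynomial_symbol "generated_semigroup M" c0 N c \<phi>
      using assms generators_mem[of M] by unfold_locales (auto simp: M_def)
    obtain C where C: "0 \<le> C"
      "\<And>x y t. 0 \<le> x \<Longrightarrow> 0 \<le> y \<Longrightarrow> cmod (\<phi> (Complex x t) - \<phi> (Complex y t)) \<le> C * \<bar>x - y\<bar>"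
      using horizontal_Lipschitz by blast
    obtain m :: nat where m: "1 + C \<le> real m" using real_arch_simple by blast
    have "\<exists>s. 0 < Re s \<and> Re (\<phi> s) < 1 / real (Suc j)" for j
    proof -
      have "(INF s\<in>right_halfplane 0. Re (\<phi> s)) < 1 / real (Suc j)"
        using True by (simp add: I_def)
      then show ?thesis
        using cINF_less_iff[OF ne bdd] by (auto simp: right_halfplane_def)
    qed
    then obtain s where s: "\<And>j. 0 < Re (s j)" "\<And>j. Re (\<phi> (s j)) < 1 / real (Suc j)" by metis
    \<comment> \<open>At \<open>s j\<close> the ratio of Re \<phi> to Re s may be unbounded. The
      horizontal move to abscissa \<open>Re (\<phi> (s j))\<close> has length at most that value,
      because \<open>Re (s j)\<close> is positive and no larger, so it raises Re \<phi> by at most C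
      times it. Hence \<open>Re (\<phi> (w j))\<close> is at most (1 + C) *
      \<open>Re (w j)\<close>.\<close>
    define w where "w = (\<lambda>j. Complex (Re (\<phi> (s j))) (Im (s j)))"
    have w0: "0 < Re (w j)" for j using Re_\<phi>(2) s(1) by (simp add: w_def)
    have "\<not> h2_compact_operator (composition_operator \<phi>)"
    proof (rule not_compact[OF refl _ self_map w0])
      show "2 \<le> M" by (simp add: M_def)
      show "(\<lambda>j. Re (w j)) \<longlonglongrightarrow> 0"
      proof (rule Lim_null_comparison[OF always_eventually LIMSEQ_inverse_real_of_nat], rule allI)
        show "norm (Re (w j)) \<le> inverse (real (Suc j))" for j
          using w0[of j] s(2)[of j] by (simp add: w_def inverse_eq_divide)
      qed
      show "0 < Re (\<phi> (w j))" for j using Re_\<phi>(2) w0 by simp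
      show "Re (\<phi> (w j)) \<le> real m * Re (w j)" for j
      proof -
        have "Re (\<phi> (w j)) - Re (\<phi> (s j)) \<le> cmod (\<phi> (w j) - \<phi> (s j))"
          by (metis complex_Re_le_cmod minus_complex.sel(1))
        also have "\<dots> \<le> C * \<bar>Re (\<phi> (s j)) - Re (s j)\<bar>"
          using C(2)[of "Re (\<phi> (s j))" "Re (s j)" "Im (s j)"] Re_\<phi>(2) s(1)
          by (simp add: w_def less_imp_le)
        also have "\<dots> \<le> C * Re (\<phi> (s j))"
          using Re_\<phi>(1)[OF s(1)] s(1)[of j] C(1) by (intro mult_left_mono) auto
        finally have "Re (\<phi> (w j)) \<le> (1 + C) * Re (w j)" by (simp add: w_def algebra_simps)
        also have "\<dots> \<le> real m * Re (w j)" using m w0[of j] by (intro mult_right_mono) auto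
        finally show ?thesis .
      qed
    qed
    then show ?thesis using restr True by simp
  qed
qed

end
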